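(* (Bethe ansatz equations) Let $M$ be a complex left $W^a$-module, $k:R^a\to\mathbb{C}$ a $W^a$-invariant multiplicity function, $\lambda\in C_k^{reg}$ and $m\in M$. Put $\psi_\lambda^m=\sum_{w\in W}e^{w\lambda}\otimes J_w^k(\lambda)m$. We have $\psi_\lambda^m\in F_{ir}^k(M)_\lambda^{W^a}$ if and only if $$J_y^k(\lambda)m=e^{\lambda(y)}m\qquad\forall\, y\in Y.$$
   Context: Root data. $V$ is a finite-dimensional real Euclidean vector space, $V^*$ its dual with the induced scalar product, $V_{\mathbb{C}},V_{\mathbb{C}}^*$ the complexifications. $R\subset V^*$ is a reduced crystallographic root system, irreducible in its span (it need not span $V^*$). For $0\ne\xi\in V^*$, $\xi^\vee\in V$ is defined by $\eta(\xi^\vee)=2\langle\eta,\xi\rangle/\langle\xi,\xi\rangle$ for all $\eta\in V^*$. $W\subset O(V)$ is the Weyl group generated by $s_\alpha(v)=v-\alpha(v)\alpha^\vee$ ($\alpha\in R$); it acts on $V_{\mathbb{C}}^*$ by the dual action. $X\subset V^*$ is a full lattice containing the root lattice $Q=\mathbb{Z}R$ and such that its dual lattice $Y=\{y\in V\mid \xi(y)\in\mathbb{Z}\ \forall \xi\in X\}$ contains the co-root lattice $Q^\vee=\mathbb{Z}R^\vee$. $t_y(v)=v+y$; $W^a=W\ltimes Y=\{wt_y\}$ is the extended affine Weyl group, acting on $V$ by isometries; $D:W^a\to W$, $D(wt_y)=w$. $R^a=\{\alpha+m1\mid\alpha\in R,m\in\mathbb{Z}\}$ is the affine root system, $a=\alpha+m1$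 being the function $a(v)=\alpha(v)+m$ on $V$; $Da:=\alpha$, $Da^\vee:=\alpha^\vee$. $W^a$ acts on $R^a$ by $(wa)(v)=a(w^{-1}v)$. $s_a(v)=v-a(v)Da^\vee$, an element of $W^a$. Fix a basis $F$ of $R$ with positive/negative roots $R^\pm$ and highest root $\theta$; $a_0=-\theta+1$, $F^a=F\cup\{a_0\}$, $R^{a,+}=(R+\mathbb{Z}_{>0}1)\cup R^+$, $R^{a,-}=-R^{a,+}$; $l(w)=\#(R^{a,+}\cap w^{-1}R^{a,-})$ and $\Omega=\{w\in W^a\mid l(w)=0\}$. A multiplicity function is a $W^a$-invariant function $k:R^a\to\mathbb{C}$, $a\mapsto k_a$. Cocycle. $C_k^{reg}=\{\lambda\in V_{\mathbb{C}}^*\mid 0\neq\lambda(Da^\vee)\neq k_a\ \forall a\in R^a\}$. For $\lambda\in C_k^{reg}$ there are unique $J_w^k(\mu)\in\mathbb{C}[W^a]$ ($w\in W^a$, $\mu\in W\lambda$) with $$J_{s_a}^k(\mu)=\frac{\mu(Da^\vee)s_a+k_a}{\mu(Da^\vee)-k_a}\ (a\in F^a),\qquad J_\omega^k(\mu)=\omega\ (\omega\in\Omega),\qquad J_{\sigma\tau}^k(\mu)=J_\sigma^k((D\tau)\mu)J_\tau^k(\mu)\ (\sigma,\tau\in W^a).$$ For $y\in Y$, $J_y^k(\lambda):=J_{t_y}^k(\lambda)$. Module. $C^\omega(V)$ is the space of complex-valued real analytic functions on $V$, with $W^a$-action $(wg)(v)=g(w^{-1}v)$; $e^\mu\in C^\omega(V)$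 is $v\mapsto e^{\mu(v)}$. $Q_{k,M}$ is the representation of $W^a$ on $C^\omega(V)\otimes_{\mathbb{C}}M$ determined by $s_a\mapsto s_a\otimes s_a-k_aI(a)\otimes\mathrm{Id}_M$ ($a\in F^a$), $\omega\mapsto\omega\otimes\omega$ ($\omega\in\Omega$), where $(I(a)f)(v)=\int_0^{a(v)}f(v-tDa^\vee)dt$. $E(\lambda)=\{g\in C^\omega(V)\mid p(\partial)g=p(\lambda)g\ \forall p\in S(V_{\mathbb{C}})^W\}$, where $p(\partial)$ is the constant coefficient differential operator associated to $p$. $F_{ir}^k(M)_\lambda=E(\lambda)\otimes_{\mathbb{C}}M$, which is stable under $Q_{k,M}$, and $F_{ir}^k(M)_\lambda^{W^a}$ is its subspace of $Q_{k,M}(W^a)$-invariants. *)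

theory Defs
  imports "HOL-Analysis.Analysis" "HOL-Library.Poly_Mapping"
begin

section \<open>Root data\<close>

text \<open>
  \<open>V\<close> is the type \<open>'v::euclidean_space\<close>, its dual \<open>V\<^sup>*\<close> is the type \<open>'v \<Rightarrow>\<^sub>L real\<close>, and the
  complexified dual is \<open>'v \<Rightarrow>\<^sub>L complex\<close>: a complex linear functional on the complexification of
  \<open>V\<close> is the same thing as a real linear map from \<open>V\<close> to the complex numbers.
\<close>

definition dual_inner :: "('v::euclidean_space \<Rightarrow>\<^sub>L real) \<Rightarrow> ('v \<Rightarrow>\<^sub>L real) \<Rightarrow> real" where
  "dual_inner \<xi> \<eta> = (\<Sum>b\<in>Basis. blinfun_apply \<xi> b * blinfun_apply \<eta> b)"

definition coroot :: "('v::euclidean_space \<Rightarrow>\<^sub>L real) \<Rightarrow> 'v" where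
  "coroot \<xi> = (THE x. \<forall>\<eta>. blinfun_apply \<eta> x = 2 * dual_inner \<eta> \<xi> / dual_inner \<xi> \<xi>)"

definition root_system :: "('v::euclidean_space \<Rightarrow>\<^sub>L real) set \<Rightarrow> bool" where
  "root_system R \<longleftrightarrow>
     finite R \<and> 0 \<notin> R \<and>
     (\<forall>\<alpha>\<in>R. (\<lambda>\<beta>. \<beta> - blinfun_apply \<beta> (coroot \<alpha>) *\<^sub>R \<alpha>) ` R = R)"

definition crystallographic :: "('v::euclidean_space \<Rightarrow>\<^sub>L real) set \<Rightarrow> bool" where
  "crystallographic R \<longleftrightarrow> (\<forall>\<alpha>\<in>R. \<forall>\<beta>\<in>R. blinfun_apply \<beta> (coroot \<alpha>) \<in> \<int>)"

definition reduced_roots :: "('v::euclidean_space \<Rightarrow>\<^sub>L real) set \<Rightarrow> bool" where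
  "reduced_roots R \<longleftrightarrow> (\<forall>\<alpha>\<in>R. \<forall>c. c *\<^sub>R \<alpha> \<in> R \<longrightarrow> c = 1 \<or> c = -1)"

definition irreducible_roots :: "('v::euclidean_space \<Rightarrow>\<^sub>L real) set \<Rightarrow> bool" where
  "irreducible_roots R \<longleftrightarrow>
     R \<noteq> {} \<and>
     \<not> (\<exists>R1 R2. R1 \<noteq> {} \<and> R2 \<noteq> {} \<and> R = R1 \<union> R2 \<and> R1 \<inter> R2 = {} \<and>
            (\<forall>\<alpha>\<in>R1. \<forall>\<beta>\<in>R2. dual_inner \<alpha> \<beta> = 0))"

definition root_refl :: "('v::euclidean_space \<Rightarrow>\<^sub>L real) \<Rightarrow> 'v \<Rightarrow> 'v" where
  "root_refl \<alpha> v = v - blinfun_apply \<alpha> v *\<^sub>R coroot \<alpha>"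

text \<open>The generators are involutions, so the monoid they generate is the group they generate.\<close>

inductive_set weyl :: "('v::euclidean_space \<Rightarrow>\<^sub>L real) set \<Rightarrow> ('v \<Rightarrow> 'v) set"
  for R :: "('v \<Rightarrow>\<^sub>L real) set" where
  weyl_id: "id \<in> weyl R"
| weyl_refl: "w \<in> weyl R \<Longrightarrow> \<alpha> \<in> R \<Longrightarrow> root_refl \<alpha> \<circ> w \<in> weyl R"

abbreviation int_span :: "'a::real_vector set \<Rightarrow> 'a set" where
  "int_span \<equiv> module.span (\<lambda>(n::int) x. of_int n *\<^sub>R x)"

definition full_lattice :: "'a::real_vector set \<Rightarrow> bool" where
  "full_lattice X \<longleftrightarrow> (\<exists>B. independent B \<and> span B = UNIV \<and> X = int_span B)"

definition dual_lattice :: "('v::euclidean_space \<Rightarrow>\<^sub>L real) set \<Rightarrow> 'v set" where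
  "dual_lattice X = {y. \<forall>\<xi>\<in>X. blinfun_apply \<xi> y \<in> \<int>}"

definition admissible_lattice ::
  "('v::euclidean_space \<Rightarrow>\<^sub>L real) set \<Rightarrow> ('v \<Rightarrow>\<^sub>L real) set \<Rightarrow> bool" where
  "admissible_lattice R X \<longleftrightarrow>
     full_lattice X \<and> int_span R \<subseteq> X \<and> int_span (coroot ` R) \<subseteq> dual_lattice X"

text \<open>\<open>W\<^sup>a\<close> is realised by its faithful action on \<open>V\<close>.\<close>

definition transl :: "'v::euclidean_space \<Rightarrow> 'v \<Rightarrow> 'v" where
  "transl y v = v + y"

definition aff_weyl ::
  "('v::euclidean_space \<Rightarrow>\<^sub>L real) set \<Rightarrow> ('v \<Rightarrow>\<^sub>L real) set \<Rightarrow> ('v \<Rightarrow> 'v) set" where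
  "aff_weyl R X = {w \<circ> transl y | w y. w \<in> weyl R \<and> y \<in> dual_lattice X}"

definition lin_part ::
  "('v::euclidean_space \<Rightarrow>\<^sub>L real) set \<Rightarrow> ('v \<Rightarrow>\<^sub>L real) set \<Rightarrow> ('v \<Rightarrow> 'v) \<Rightarrow> 'v \<Rightarrow> 'v" where
  "lin_part R X g = (THE w. w \<in> weyl R \<and> (\<exists>y\<in>dual_lattice X. g = w \<circ> transl y))"

text \<open>
  \<open>(g f)(v) = f (g\<^sup>-\<^sup>1 v)\<close>; used both for affine roots and for complex-valued functions on \<open>V\<close>.
\<close>

definition fun_act :: "('v \<Rightarrow> 'v) \<Rightarrow> ('v \<Rightarrow> 'b) \<Rightarrow> 'v \<Rightarrow> 'b" where
  "fun_act g f = (\<lambda>v. f (inv g v))"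

definition dual_act ::
  "('v::euclidean_space \<Rightarrow> 'v) \<Rightarrow> ('v \<Rightarrow>\<^sub>L complex) \<Rightarrow> ('v \<Rightarrow>\<^sub>L complex)" where
  "dual_act w \<mu> = Blinfun (\<lambda>v. blinfun_apply \<mu> (inv w v))"

section \<open>Affine roots\<close>

definition aff_fun :: "('v::euclidean_space \<Rightarrow>\<^sub>L real) \<Rightarrow> int \<Rightarrow> 'v \<Rightarrow> real" where
  "aff_fun \<alpha> m = (\<lambda>v. blinfun_apply \<alpha> v + of_int m)"

definition aff_roots :: "('v::euclidean_space \<Rightarrow>\<^sub>L real) set \<Rightarrow> ('v \<Rightarrow> real) set" where
  "aff_roots R = {aff_fun \<alpha> m | \<alpha> m. \<alpha> \<in> R}"

definition grad :: "('v::euclidean_space \<Rightarrow> real) \<Rightarrow> ('v \<Rightarrow>\<^sub>L real)" where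
  "grad a = (THE \<alpha>. \<exists>m. a = aff_fun \<alpha> m)"

abbreviation aff_coroot :: "('v::euclidean_space \<Rightarrow> real) \<Rightarrow> 'v" where
  "aff_coroot a \<equiv> coroot (grad a)"

definition aff_refl :: "('v::euclidean_space \<Rightarrow> real) \<Rightarrow> 'v \<Rightarrow> 'v" where
  "aff_refl a v = v - a v *\<^sub>R aff_coroot a"

definition nat_comb :: "('v::euclidean_space \<Rightarrow>\<^sub>L real) set \<Rightarrow> ('v \<Rightarrow>\<^sub>L real) set" where
  "nat_comb F = {\<Sum>\<beta>\<in>F. of_nat (c \<beta>) *\<^sub>R \<beta> | c :: ('v \<Rightarrow>\<^sub>L real) \<Rightarrow> nat. True}"

definition root_basis ::
  "('v::euclidean_space \<Rightarrow>\<^sub>L real) set \<Rightarrow> ('v \<Rightarrow>\<^sub>L real) set \<Rightarrow> bool" where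
  "root_basis R F \<longleftrightarrow>
     F \<subseteq> R \<and> independent F \<and> (\<forall>\<alpha>\<in>R. \<alpha> \<in> nat_comb F \<or> - \<alpha> \<in> nat_comb F)"

definition pos_roots ::
  "('v::euclidean_space \<Rightarrow>\<^sub>L real) set \<Rightarrow> ('v \<Rightarrow>\<^sub>L real) set \<Rightarrow> ('v \<Rightarrow>\<^sub>L real) set" where
  "pos_roots R F = R \<inter> nat_comb F"

definition highest_root ::
  "('v::euclidean_space \<Rightarrow>\<^sub>L real) set \<Rightarrow> ('v \<Rightarrow>\<^sub>L real) set \<Rightarrow> ('v \<Rightarrow>\<^sub>L real) \<Rightarrow> bool" where
  "highest_root R F \<theta> \<longleftrightarrow> \<theta> \<in> R \<and> (\<forall>\<alpha>\<in>R. \<theta> - \<alpha> \<in> nat_comb F)"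

definition aff_basis ::
  "('v::euclidean_space \<Rightarrow>\<^sub>L real) set \<Rightarrow> ('v \<Rightarrow>\<^sub>L real) \<Rightarrow> ('v \<Rightarrow> real) set" where
  "aff_basis F \<theta> = (\<lambda>\<beta>. aff_fun \<beta> 0) ` F \<union> {aff_fun (- \<theta>) 1}"

definition aff_pos ::
  "('v::euclidean_space \<Rightarrow>\<^sub>L real) set \<Rightarrow> ('v \<Rightarrow>\<^sub>L real) set \<Rightarrow> ('v \<Rightarrow> real) set" where
  "aff_pos R F =
     {aff_fun \<alpha> m | \<alpha> m. \<alpha> \<in> R \<and> m > 0} \<union> {aff_fun \<alpha> 0 | \<alpha>. \<alpha> \<in> pos_roots R F}"

definition aff_neg ::
  "('v::euclidean_space \<Rightarrow>\<^sub>L real) set \<Rightarrow> ('v \<Rightarrow>\<^sub>L real) set \<Rightarrow> ('v \<Rightarrow> real) set" where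
  "aff_neg R F = (\<lambda>a v. - a v) ` aff_pos R F"

text \<open>
  The set counted by \<open>aff_length\<close> is finite for every \<open>g\<close> in \<open>W\<^sup>a\<close>, so the convention that infinite
  sets have cardinality 0 plays no role in \<open>omega_grp\<close>.
\<close>

definition aff_length ::
  "('v::euclidean_space \<Rightarrow>\<^sub>L real) set \<Rightarrow> ('v \<Rightarrow>\<^sub>L real) set \<Rightarrow> ('v \<Rightarrow> 'v) \<Rightarrow> nat" where
  "aff_length R F g = card (aff_pos R F \<inter> fun_act (inv g) ` aff_neg R F)"

definition omega_grp ::
  "('v::euclidean_space \<Rightarrow>\<^sub>L real) set \<Rightarrow> ('v \<Rightarrow>\<^sub>L real) set \<Rightarrow> ('v \<Rightarrow>\<^sub>L real) set \<Rightarrow> ('v \<Rightarrow> 'v) set"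
  where
  "omega_grp R X F = {g \<in> aff_weyl R X. aff_length R F g = 0}"

definition multiplicity_function ::
  "('v::euclidean_space \<Rightarrow>\<^sub>L real) set \<Rightarrow> ('v \<Rightarrow>\<^sub>L real) set \<Rightarrow> (('v \<Rightarrow> real) \<Rightarrow> complex) \<Rightarrow> bool" where
  "multiplicity_function R X k \<longleftrightarrow>
     (\<forall>g\<in>aff_weyl R X. \<forall>a\<in>aff_roots R. k (fun_act g a) = k a)"

section \<open>The group algebra and the cocycle\<close>

text \<open>
  Elements of the group algebra of \<open>W\<^sup>a\<close> are finitely supported functions; \<open>single g c\<close> is \<open>c\<close> times
  the group element \<open>g\<close>.  The multiplication of the type \<open>\<Rightarrow>\<^sub>0\<close> is not available, as it requires
  an additive monoid of keys.
\<close>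

type_synonym 'v grp_alg = "('v \<Rightarrow> 'v) \<Rightarrow>\<^sub>0 complex"

definition grp_alg ::
  "('v::euclidean_space \<Rightarrow>\<^sub>L real) set \<Rightarrow> ('v \<Rightarrow>\<^sub>L real) set \<Rightarrow> 'v grp_alg set" where
  "grp_alg R X = {x. Poly_Mapping.keys x \<subseteq> aff_weyl R X}"

definition ga_mult :: "'v grp_alg \<Rightarrow> 'v grp_alg \<Rightarrow> 'v grp_alg" where
  "ga_mult x y =
     (\<Sum>g\<in>Poly_Mapping.keys x. \<Sum>h\<in>Poly_Mapping.keys y.
        Poly_Mapping.single (g \<circ> h) (Poly_Mapping.lookup x g * Poly_Mapping.lookup y h))"

definition C_reg ::
  "('v::euclidean_space \<Rightarrow>\<^sub>L real) set \<Rightarrow> (('v \<Rightarrow> real) \<Rightarrow> complex) \<Rightarrow> ('v \<Rightarrow>\<^sub>L complex) set" where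
  "C_reg R k =
     {lam. \<forall>a\<in>aff_roots R.
        blinfun_apply lam (aff_coroot a) \<noteq> 0 \<and> blinfun_apply lam (aff_coroot a) \<noteq> k a}"

text \<open>
  \<open>cocycle R X F \<theta> k lam J\<close> says that \<open>J g \<mu>\<close> is the cocycle value \<open>J\<^sub>g\<^sup>k(\<mu>)\<close> for all \<open>g\<close> in \<open>W\<^sup>a\<close> and
  all \<open>\<mu>\<close> in the orbit \<open>W lam\<close>.  These conditions determine such values uniquely.
\<close>

definition cocycle ::
  "('v::euclidean_space \<Rightarrow>\<^sub>L real) set \<Rightarrow> ('v \<Rightarrow>\<^sub>L real) set \<Rightarrow> ('v \<Rightarrow>\<^sub>L real) set \<Rightarrow> ('v \<Rightarrow>\<^sub>L real) \<Rightarrow>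
    (('v \<Rightarrow> real) \<Rightarrow> complex) \<Rightarrow> ('v \<Rightarrow>\<^sub>L complex) \<Rightarrow>
    (('v \<Rightarrow> 'v) \<Rightarrow> ('v \<Rightarrow>\<^sub>L complex) \<Rightarrow> 'v grp_alg) \<Rightarrow> bool" where
  "cocycle R X F \<theta> k lam J \<longleftrightarrow>
     (\<forall>\<mu> \<in> (\<lambda>w. dual_act w lam) ` weyl R.
        (\<forall>g\<in>aff_weyl R X. J g \<mu> \<in> grp_alg R X) \<and>
        (\<forall>a\<in>aff_basis F \<theta>.
           J (aff_refl a) \<mu> =
             (let z = blinfun_apply \<mu> (aff_coroot a) in
                Poly_Mapping.single (aff_refl a) (z / (z - k a)) +
                Poly_Mapping.single id (k a / (z - k a)))) \<and>
        (\<forall>\<omega>\<in>omega_grp R X F. J \<omega> \<mu> = Poly_Mapping.single \<omega> 1) \<and>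
        (\<forall>\<sigma>\<in>aff_weyl R X. \<forall>\<tau>\<in>aff_weyl R X.
           J (\<sigma> \<circ> \<tau>) \<mu> = ga_mult (J \<sigma> (dual_act (lin_part R X \<tau>) \<mu>)) (J \<tau> \<mu>)))"

section \<open>Modules and tensor products\<close>

text \<open>
  \<open>M\<close> is the type \<open>'m\<close> with complex scalar multiplication \<open>sm\<close>, and \<open>\<rho>\<close> is the action of \<open>W\<^sup>a\<close>.
\<close>

definition aff_weyl_module ::
  "('v::euclidean_space \<Rightarrow>\<^sub>L real) set \<Rightarrow> ('v \<Rightarrow>\<^sub>L real) set \<Rightarrow>
    (complex \<Rightarrow> 'm::ab_group_add \<Rightarrow> 'm) \<Rightarrow> (('v \<Rightarrow> 'v) \<Rightarrow> 'm \<Rightarrow> 'm) \<Rightarrow> bool" where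
  "aff_weyl_module R X sm \<rho> \<longleftrightarrow>
     vector_space sm \<and>
     (\<forall>g\<in>aff_weyl R X. Vector_Spaces.linear sm sm (\<rho> g)) \<and>
     \<rho> id = id \<and>
     (\<forall>g\<in>aff_weyl R X. \<forall>h\<in>aff_weyl R X. \<rho> (g \<circ> h) = \<rho> g \<circ> \<rho> h)"

definition ga_act ::
  "(complex \<Rightarrow> 'm::ab_group_add \<Rightarrow> 'm) \<Rightarrow> (('v \<Rightarrow> 'v) \<Rightarrow> 'm \<Rightarrow> 'm) \<Rightarrow> 'v grp_alg \<Rightarrow> 'm \<Rightarrow> 'm" where
  "ga_act sm \<rho> x m =
     (\<Sum>g\<in>Poly_Mapping.keys x. sm (Poly_Mapping.lookup x g) (\<rho> g m))"

text \<open>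
  For a linear space \<open>A\<close> of complex-valued functions on \<open>V\<close>, the tensor product of \<open>A\<close> and \<open>M\<close> is
  realised as the space of functions from \<open>V\<close> to \<open>M\<close> spanned by the pure tensors
  \<open>v \<mapsto> f v \<cdot> m\<close>.  Lemma \<open>tensor_universal\<close> shows that this is a model of the
  algebraic tensor product: every bilinear map on \<open>A \<times> M\<close> factors through the pure tensors.
\<close>

definition pure_tensor ::
  "(complex \<Rightarrow> 'm \<Rightarrow> 'm) \<Rightarrow> ('v \<Rightarrow> complex) \<Rightarrow> 'm \<Rightarrow> 'v \<Rightarrow> 'm" where
  "pure_tensor sm f m = (\<lambda>v. sm (f v) m)"

definition tensor_space ::
  "(complex \<Rightarrow> 'm::ab_group_add \<Rightarrow> 'm) \<Rightarrow> ('v \<Rightarrow> complex) set \<Rightarrow> ('v \<Rightarrow> 'm) set" where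
  "tensor_space sm A =
     {\<lambda>v. \<Sum>i<n. pure_tensor sm (f i) (m i) v | (n::nat) f m. \<forall>i<n. f i \<in> A}"

lemma tensor_universal:
  fixes sm :: "complex \<Rightarrow> 'm::ab_group_add \<Rightarrow> 'm"
    and smZ :: "complex \<Rightarrow> 'z::ab_group_add \<Rightarrow> 'z"
    and B :: "('v \<Rightarrow> complex) \<Rightarrow> 'm \<Rightarrow> 'z"
  assumes M: "vector_space sm" and Z: "vector_space smZ"
    and A0: "(\<lambda>_. 0) \<in> A"
    and A_add: "\<And>f g. f \<in> A \<Longrightarrow> g \<in> A \<Longrightarrow> (\<lambda>v. f v + g v) \<in> A"
    and A_scale: "\<And>c f. f \<in> A \<Longrightarrow> (\<lambda>v. c * f v) \<in> A"
    and B_addl: "\<And>f g m. f \<in> A \<Longrightarrow> g \<in> A \<Longrightarrow> B (\<lambda>v. f v + g v) m = B f m + B g m"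
    and B_scalel: "\<And>c f m. f \<in> A \<Longrightarrow> B (\<lambda>v. c * f v) m = smZ c (B f m)"
    and B_linr: "\<And>f. f \<in> A \<Longrightarrow> Vector_Spaces.linear sm smZ (B f)"
    and fA: "\<And>i. i < (n::nat) \<Longrightarrow> f i \<in> A"
    and zero: "\<And>v. (\<Sum>i<n. pure_tensor sm (f i) (m i) v) = 0"
  shows "(\<Sum>i<n. B (f i) (m i)) = 0"
proof -
  interpret M: vector_space sm by (rule M)
  interpret Z: vector_space smZ by (rule Z)
  obtain S where S: "S \<subseteq> m ` {..<n}" "M.independent S" "m ` {..<n} \<subseteq> M.span S"
    using M.maximal_independent_subset[of "m ` {..<n}"] by metis
  have finS: "finite S" using S(1) finite_subset by blast
  have "\<forall>i\<in>{..<n}. \<exists>c. m i = (\<Sum>s\<in>S. sm (c s) s)"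
    using S(3) M.span_finite[OF finS] by auto
  then obtain c where c: "\<And>i. i < n \<Longrightarrow> m i = (\<Sum>s\<in>S. sm (c i s) s)"
    by (metis lessThan_iff)
  have g0: "(\<Sum>i<n. c i s * f i v) = 0" if "s \<in> S" for s v
  proof -
    have "0 = (\<Sum>i<n. sm (f i v) (m i))"
      using zero by (simp add: pure_tensor_def)
    also have "\<dots> = (\<Sum>i<n. sm (f i v) (\<Sum>s\<in>S. sm (c i s) s))"
      by (intro sum.cong refl) (use c in force)
    also have "\<dots> = (\<Sum>i<n. \<Sum>s\<in>S. sm (c i s * f i v) s)"
      by (simp add: M.scale_sum_right mult.commute)
    also have "\<dots> = (\<Sum>s\<in>S. \<Sum>i<n. sm (c i s * f i v) s)"
      by (rule sum.swap)
    also have "\<dots> = (\<Sum>s\<in>S. sm (\<Sum>i<n. c i s * f i v) s)"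
      by (simp add: M.scale_sum_left)
    finally have "(\<Sum>s\<in>S. sm (\<Sum>i<n. c i s * f i v) s) = 0" by simp
    then show ?thesis
      using M.independentD[OF S(2) finS order_refl _ that, of "\<lambda>s. \<Sum>i<n. c i s * f i v"] by simp
  qed
  have B0: "B (\<lambda>_. 0) s = 0" for s
    using B_scalel[OF A0, of 0 s] by simp
  have comb: "(\<lambda>v. \<Sum>i<j. c i s * f i v) \<in> A \<and>
      B (\<lambda>v. \<Sum>i<j. c i s * f i v) s = (\<Sum>i<j. smZ (c i s) (B (f i) s))"
    if "j \<le> n" for j s
    using that
  proof (induction j)
    case 0
    show ?case using A0 B0 by simp
  next
    case (Suc j)
    then have IH: "(\<lambda>v. \<Sum>i<j. c i s * f i v) \<in> A"
      "B (\<lambda>v. \<Sum>i<j. c i s * f i v) s = (\<Sum>i<j. smZ (c i s) (B (f i) s))"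
      by auto
    have fj: "f j \<in> A" using Suc.prems fA by simp
    show ?case
      using A_add[OF IH(1) A_scale[OF fj, of "c j s"]]
        B_addl[OF IH(1) A_scale[OF fj, of "c j s"], of s] B_scalel[OF fj, of "c j s" s] IH(2)
      by simp
  qed
  have "(\<Sum>i<n. B (f i) (m i)) = (\<Sum>i<n. \<Sum>s\<in>S. smZ (c i s) (B (f i) s))"
  proof (rule sum.cong[OF refl])
    fix i assume "i \<in> {..<n}"
    then have i: "i < n" by simp
    interpret L: Vector_Spaces.linear sm smZ "B (f i)" by (rule B_linr[OF fA[OF i]])
    show "B (f i) (m i) = (\<Sum>s\<in>S. smZ (c i s) (B (f i) s))"
      using c[OF i] by (simp add: L.sum L.scale)
  qed
  also have "\<dots> = (\<Sum>s\<in>S. \<Sum>i<n. smZ (c i s) (B (f i) s))"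
    by (rule sum.swap)
  also have "\<dots> = (\<Sum>s\<in>S. B (\<lambda>v. \<Sum>i<n. c i s * f i v) s)"
    using comb[OF order_refl] by simp
  also have "\<dots> = (\<Sum>s\<in>S. B (\<lambda>_. 0) s)"
    by (intro sum.cong refl) (simp add: g0)
  also have "\<dots> = 0" by (simp add: B0)
  finally show ?thesis .
qed

section \<open>Analytic functions, constant coefficient differential operators\<close>

text \<open>Real analytic: near every point, the sum of a power series in the coordinates.\<close>

definition real_analytic :: "('v::euclidean_space \<Rightarrow> complex) set" where
  "real_analytic =
     {f. \<forall>x. \<exists>r>0. \<exists>c :: ('v \<Rightarrow>\<^sub>0 nat) \<Rightarrow> complex. \<forall>h. norm h < r \<longrightarrow>
        ((\<lambda>\<nu>. c \<nu> * of_real (\<Prod>b\<in>Basis. (h \<bullet> b) ^ Poly_Mapping.lookup \<nu> b))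
           has_sum f (x + h)) {\<nu>. Poly_Mapping.keys \<nu> \<subseteq> Basis}}"

definition cexp :: "('v::euclidean_space \<Rightarrow>\<^sub>L complex) \<Rightarrow> 'v \<Rightarrow> complex" where
  "cexp \<mu> = (\<lambda>v. exp (blinfun_apply \<mu> v))"

text \<open>
  The symmetric algebra of the complexification of \<open>V\<close> is the polynomial ring over the complex
  numbers in the variables \<open>b \<in> Basis\<close>; \<open>w\<close> acts on it by the algebra automorphism that replaces
  the variable \<open>b\<close> by the linear form corresponding to the vector \<open>w b\<close>.
\<close>

type_synonym 'v sym_poly = "('v \<Rightarrow>\<^sub>0 nat) \<Rightarrow>\<^sub>0 complex"

definition sym_alg :: "'v::euclidean_space sym_poly set" where
  "sym_alg = {p. \<forall>\<nu>\<in>Poly_Mapping.keys p. Poly_Mapping.keys \<nu> \<subseteq> Basis}"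

definition sym_vec :: "'v::euclidean_space \<Rightarrow> 'v sym_poly" where
  "sym_vec v =
     (\<Sum>b\<in>Basis. Poly_Mapping.single (Poly_Mapping.single b 1) (of_real (v \<bullet> b)))"

definition sym_act :: "('v::euclidean_space \<Rightarrow> 'v) \<Rightarrow> 'v sym_poly \<Rightarrow> 'v sym_poly" where
  "sym_act w p =
     (\<Sum>\<nu>\<in>Poly_Mapping.keys p. Poly_Mapping.single 0 (Poly_Mapping.lookup p \<nu>) *
        (\<Prod>b\<in>Basis. sym_vec (w b) ^ Poly_Mapping.lookup \<nu> b))"

definition sym_invariants ::
  "('v::euclidean_space \<Rightarrow>\<^sub>L real) set \<Rightarrow> 'v sym_poly set" where
  "sym_invariants R = {p \<in> sym_alg. \<forall>w\<in>weyl R. sym_act w p = p}"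

definition sym_eval :: "'v::euclidean_space sym_poly \<Rightarrow> ('v \<Rightarrow>\<^sub>L complex) \<Rightarrow> complex" where
  "sym_eval p \<mu> =
     (\<Sum>\<nu>\<in>Poly_Mapping.keys p. Poly_Mapping.lookup p \<nu> *
        (\<Prod>b\<in>Basis. blinfun_apply \<mu> b ^ Poly_Mapping.lookup \<nu> b))"

definition dir_deriv :: "'v::euclidean_space \<Rightarrow> ('v \<Rightarrow> complex) \<Rightarrow> 'v \<Rightarrow> complex" where
  "dir_deriv b g = (\<lambda>x. vector_derivative (\<lambda>t. g (x + t *\<^sub>R b)) (at 0))"

text \<open>
  The operators \<open>dir_deriv b\<close> commute on analytic functions, so the chosen order of the
  coordinates is immaterial.
\<close>

definition basis_list :: "'v::euclidean_space list" where
  "basis_list = (SOME bs. set bs = Basis \<and> distinct bs)"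

definition mono_deriv :: "('v::euclidean_space \<Rightarrow>\<^sub>0 nat) \<Rightarrow> ('v \<Rightarrow> complex) \<Rightarrow> 'v \<Rightarrow> complex" where
  "mono_deriv \<nu> g = foldr (\<lambda>b. dir_deriv b ^^ Poly_Mapping.lookup \<nu> b) basis_list g"

definition sym_diff :: "'v::euclidean_space sym_poly \<Rightarrow> ('v \<Rightarrow> complex) \<Rightarrow> 'v \<Rightarrow> complex" where
  "sym_diff p g =
     (\<lambda>x. \<Sum>\<nu>\<in>Poly_Mapping.keys p. Poly_Mapping.lookup p \<nu> * mono_deriv \<nu> g x)"

definition E_space ::
  "('v::euclidean_space \<Rightarrow>\<^sub>L real) set \<Rightarrow> ('v \<Rightarrow>\<^sub>L complex) \<Rightarrow> ('v \<Rightarrow> complex) set" where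
  "E_space R lam =
     {g \<in> real_analytic. \<forall>p\<in>sym_invariants R. sym_diff p g = (\<lambda>x. sym_eval p lam * g x)}"

section \<open>The representation on vector-valued functions\<close>

text \<open>The interval integral is oriented, as needed for \<open>a v < 0\<close>.\<close>

definition int_op :: "('v::euclidean_space \<Rightarrow> real) \<Rightarrow> ('v \<Rightarrow> complex) \<Rightarrow> 'v \<Rightarrow> complex" where
  "int_op a f v = (LBINT t=ereal 0..ereal (a v). f (v - t *\<^sub>R aff_coroot a))"

text \<open>
  \<open>Q_rep R X F \<theta> k sm \<rho> Q\<close> says that \<open>Q\<close> is the representation \<open>Q\<^sub>k\<^sub>,\<^sub>M\<close>.  An operator of the form
  \<open>S \<otimes> T\<close> is given by its values on pure tensors; the values of \<open>Q\<close> on the generators of \<open>W\<^sup>a\<close>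
  determine \<open>Q\<close>.
\<close>

definition Q_rep ::
  "('v::euclidean_space \<Rightarrow>\<^sub>L real) set \<Rightarrow> ('v \<Rightarrow>\<^sub>L real) set \<Rightarrow> ('v \<Rightarrow>\<^sub>L real) set \<Rightarrow> ('v \<Rightarrow>\<^sub>L real) \<Rightarrow>
    (('v \<Rightarrow> real) \<Rightarrow> complex) \<Rightarrow> (complex \<Rightarrow> 'm::ab_group_add \<Rightarrow> 'm) \<Rightarrow> (('v \<Rightarrow> 'v) \<Rightarrow> 'm \<Rightarrow> 'm) \<Rightarrow>
    (('v \<Rightarrow> 'v) \<Rightarrow> ('v \<Rightarrow> 'm) \<Rightarrow> ('v \<Rightarrow> 'm)) \<Rightarrow> bool" where
  "Q_rep R X F \<theta> k sm \<rho> Q \<longleftrightarrow>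
     (let T = tensor_space sm real_analytic in
      (\<forall>g\<in>aff_weyl R X.
         (\<forall>\<phi>\<in>T. Q g \<phi> \<in> T) \<and>
         (\<forall>\<phi>\<in>T. \<forall>\<psi>\<in>T. Q g (\<lambda>v. \<phi> v + \<psi> v) = (\<lambda>v. Q g \<phi> v + Q g \<psi> v)) \<and>
         (\<forall>c. \<forall>\<phi>\<in>T. Q g (\<lambda>v. sm c (\<phi> v)) = (\<lambda>v. sm c (Q g \<phi> v)))) \<and>
      (\<forall>\<phi>\<in>T. Q id \<phi> = \<phi>) \<and>
      (\<forall>g\<in>aff_weyl R X. \<forall>h\<in>aff_weyl R X. \<forall>\<phi>\<in>T. Q (g \<circ> h) \<phi> = Q g (Q h \<phi>)) \<and>
      (\<forall>a\<in>aff_basis F \<theta>. \<forall>f\<in>real_analytic. \<forall>m.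
         Q (aff_refl a) (pure_tensor sm f m) =
           (\<lambda>v. pure_tensor sm (fun_act (aff_refl a) f) (\<rho> (aff_refl a) m) v
                - sm (k a) (pure_tensor sm (int_op a f) m v))) \<and>
      (\<forall>\<omega>\<in>omega_grp R X F. \<forall>f\<in>real_analytic. \<forall>m.
         Q \<omega> (pure_tensor sm f m) = pure_tensor sm (fun_act \<omega> f) (\<rho> \<omega> m)))"

definition F_ir ::
  "('v::euclidean_space \<Rightarrow>\<^sub>L real) set \<Rightarrow> (complex \<Rightarrow> 'm::ab_group_add \<Rightarrow> 'm) \<Rightarrow>
    ('v \<Rightarrow>\<^sub>L complex) \<Rightarrow> ('v \<Rightarrow> 'm) set" where
  "F_ir R sm lam = tensor_space sm (E_space R lam)"

definition F_ir_inv ::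
  "('v::euclidean_space \<Rightarrow>\<^sub>L real) set \<Rightarrow> ('v \<Rightarrow>\<^sub>L real) set \<Rightarrow> (complex \<Rightarrow> 'm::ab_group_add \<Rightarrow> 'm) \<Rightarrow>
    (('v \<Rightarrow> 'v) \<Rightarrow> ('v \<Rightarrow> 'm) \<Rightarrow> ('v \<Rightarrow> 'm)) \<Rightarrow> ('v \<Rightarrow>\<^sub>L complex) \<Rightarrow> ('v \<Rightarrow> 'm) set" where
  "F_ir_inv R X sm Q lam = {\<phi> \<in> F_ir R sm lam. \<forall>g\<in>aff_weyl R X. Q g \<phi> = \<phi>}"

definition bethe_wave ::
  "('v::euclidean_space \<Rightarrow>\<^sub>L real) set \<Rightarrow> (complex \<Rightarrow> 'm::ab_group_add \<Rightarrow> 'm) \<Rightarrow>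
    (('v \<Rightarrow> 'v) \<Rightarrow> 'm \<Rightarrow> 'm) \<Rightarrow> (('v \<Rightarrow> 'v) \<Rightarrow> ('v \<Rightarrow>\<^sub>L complex) \<Rightarrow> 'v grp_alg) \<Rightarrow>
    ('v \<Rightarrow>\<^sub>L complex) \<Rightarrow> 'm \<Rightarrow> 'v \<Rightarrow> 'm" where
  "bethe_wave R sm \<rho> J lam m =
     (\<lambda>v. \<Sum>w\<in>weyl R. pure_tensor sm (cexp (dual_act w lam)) (ga_act sm \<rho> (J w lam) m) v)"

end

theory Submission
  imports Defs
begin

text \<open>
  For \<open>\<mu> = w\<lambda>\<close> put \<open>n(\<mu>) = J\<^sub>w(\<lambda>)m\<close>.  The integral \<open>I(a)e\<^sup>\<mu>\<close> equals \<open>(e\<^sup>\<mu> - s\<^sub>a e\<^sup>\<mu>) / \<mu>(Da\<^sup>\<or>)\<close>,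
  so comparing coefficients of the linearly independent exponentials shows that
  \<open>\<psi> = \<Sum> e\<^sup>\<mu> \<otimes> n(\<mu>)\<close> is invariant under a generator \<open>g\<close> (some \<open>s\<^sub>a\<close>, or an element of \<open>\<Omega>\<close>) if
  and only if \<open>n(Dg \<mu>) = exp(\<mu>(g\<^sup>-\<^sup>1 0)) J\<^sub>g(\<mu>) n(\<mu>)\<close> for all \<open>\<mu>\<close>.  Both factors are cocycles, so this
  compatibility passes to products and hence, as the generators exhaust \<open>W\<^sup>a\<close>, to every \<open>g\<close>.  It
  holds for \<open>g \<in> W\<close> by construction; for \<open>g = t\<^sub>y\<close> and \<open>\<mu> = \<lambda>\<close> it is the Bethe equation, which
  implies it for the other \<open>\<mu>\<close>.  The exponentials are distinct because a regular \<open>\<lambda>\<close> has trivial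
  stabilizer in \<open>W\<close>.
\<close>

section \<open>Exponentials\<close>

text \<open>The Bethe equations speak of translations, whereas \<open>Q\<close> is prescribed only
  on \<Omega> and on the simple affine reflections. The bridge between the two is geometric: the
  length counts the affine root hyperplanes between two alcoves, and a suitable reflection in a wall
  of the fundamental alcove lowers the count. The two halves of regularity have different roles.
  That \<mu> does not vanish on affine coroots gives the formula for the integral operator and the
  trivial stabilizer. That its value z there differs from \<open>k a\<close> keeps the factor (z -
  \<open>k a\<close>) / z away from zero; this factor relates the defect of invariance to the defect
  of compatibility, so that the two conditions are equivalent for a generator. Two obstacles shape
  the finite part: the stabilizer theorem is about real points while \<open>lam\<close> is complex,
  and \<open>R\<close> need not span the dual, so the Weyl group has to be controlled on the span of
  the coroots.\<close>

lemma abs_summable_mult_Times: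
  fixes f :: "'a \<Rightarrow> 'c::{banach, real_normed_field}" and g :: "'b \<Rightarrow> 'c"
  assumes "(\<lambda>x. norm (f x)) summable_on A" "(\<lambda>x. norm (g x)) summable_on B"
  shows "(\<lambda>z. norm (case z of (x, y) \<Rightarrow> f x * g y)) summable_on A \<times> B"
  using Infinite_Sum.abs_summable_on_Sigma_iff[where
      f = "\<lambda>(x, y). f x * g y" and A = A and B = "\<lambda>_. B"] assms
  by (auto simp: norm_mult infsum_cmult_right' abs_mult abs_of_nonneg infsum_nonneg
      intro!: summable_on_cmult_right summable_on_cmult_left)

lemma has_sum_mult_Times:
  fixes f :: "'a \<Rightarrow> 'c::{banach, real_normed_field}" and g :: "'b \<Rightarrow> 'c"
  assumes "(\<lambda>x. norm (f x)) summable_on A" "(\<lambda>x. norm (g x)) summable_on B"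
    "(f has_sum s) A" "(g has_sum t) B"
  shows "((\<lambda>(x, y). f x * g y) has_sum (s * t)) (A \<times> B)"
proof (rule has_sum_SigmaI[where g = "\<lambda>x. f x * t"])
  show "((\<lambda>y. case (x, y) of (x, y) \<Rightarrow> f x * g y) has_sum f x * t) B" for x
    using has_sum_cmult_right[OF assms(4)] by simp
  show "((\<lambda>x. f x * t) has_sum s * t) A"
    using has_sum_cmult_left[OF assms(3)] .
  show "(\<lambda>(x, y). f x * g y) summable_on A \<times> B"
    by (rule abs_summable_summable[OF abs_summable_mult_Times[OF assms(1,2)]])
qed

text \<open>This is how an induction over variables peels off one of them: an exponent over
  \<open>insert b B\<close> is an exponent over \<open>B\<close> together with the power of
  \<open>b\<close>.\<close>

lemma bij_betw_add_single:
  fixes b :: 'a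
  assumes "b \<notin> B"
  shows "bij_betw (\<lambda>(\<nu>, n). \<nu> + Poly_Mapping.single b n)
    ({\<nu> :: 'a \<Rightarrow>\<^sub>0 nat. Poly_Mapping.keys \<nu> \<subseteq> B} \<times> UNIV)
    {\<nu>. Poly_Mapping.keys \<nu> \<subseteq> insert b B}"
proof (rule bij_betw_byWitness[where
      f' = "\<lambda>\<nu>. (\<nu> - Poly_Mapping.single b (Poly_Mapping.lookup \<nu> b), Poly_Mapping.lookup \<nu> b)"])
  have b0: "Poly_Mapping.lookup \<nu> b = 0" if "Poly_Mapping.keys \<nu> \<subseteq> B" for \<nu> :: "'a \<Rightarrow>\<^sub>0 nat"
    using that assms in_keys_iff[of b \<nu>] by auto
  show "\<forall>a\<in>{\<nu> :: 'a \<Rightarrow>\<^sub>0 nat. Poly_Mapping.keys \<nu> \<subseteq> B} \<times> UNIV.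
     (\<lambda>\<nu>. (\<nu> - Poly_Mapping.single b (Poly_Mapping.lookup \<nu> b), Poly_Mapping.lookup \<nu> b))
       (case a of (\<nu>, n) \<Rightarrow> \<nu> + Poly_Mapping.single b n) = a"
    using b0 by (auto intro!: poly_mapping_eqI simp: lookup_add lookup_minus lookup_single when_def)
  show "\<forall>a'\<in>{\<nu>. Poly_Mapping.keys \<nu> \<subseteq> insert b B}.
     (case (a' - Poly_Mapping.single b (Poly_Mapping.lookup a' b), Poly_Mapping.lookup a' b) of
        (\<nu>, n) \<Rightarrow> \<nu> + Poly_Mapping.single b n) = a'"
    by (auto intro!: poly_mapping_eqI simp: lookup_add lookup_minus lookup_single when_def)
  show "(\<lambda>(\<nu>, n). \<nu> + Poly_Mapping.single b n) ` ({\<nu>. Poly_Mapping.keys \<nu> \<subseteq> B} \<times> UNIV)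
    \<subseteq> {\<nu>. Poly_Mapping.keys \<nu> \<subseteq> insert b B}"
    using keys_add by (fastforce split: if_splits)
  show "(\<lambda>\<nu>. (\<nu> - Poly_Mapping.single b (Poly_Mapping.lookup \<nu> b), Poly_Mapping.lookup \<nu> b)) `
      {\<nu>. Poly_Mapping.keys \<nu> \<subseteq> insert b B} \<subseteq> {\<nu>. Poly_Mapping.keys \<nu> \<subseteq> B} \<times> UNIV"
    by (auto simp: in_keys_iff lookup_minus lookup_single when_def split: if_splits)
qed

text \<open>Absolute convergence is part of the conclusion because the induction step multiplies two
  series and needs it for both factors.\<close>

lemma has_sum_prod_poly_mapping:
  fixes f :: "'a \<Rightarrow> nat \<Rightarrow> 'c::{banach, real_normed_field}"
  assumes "finite B"
    and "\<And>b. b \<in> B \<Longrightarrow> (\<lambda>n. norm (f b n)) summable_on UNIV"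
    and "\<And>b. b \<in> B \<Longrightarrow> (f b has_sum s b) UNIV"
  shows "(\<lambda>\<nu>. norm (\<Prod>b\<in>B. f b (Poly_Mapping.lookup \<nu> b))) summable_on {\<nu>. Poly_Mapping.keys \<nu> \<subseteq> B}
    \<and> ((\<lambda>\<nu>. \<Prod>b\<in>B. f b (Poly_Mapping.lookup \<nu> b)) has_sum (\<Prod>b\<in>B. s b))
        {\<nu>. Poly_Mapping.keys \<nu> \<subseteq> B}"
  using assms
proof (induction B rule: finite_induct)
  case empty
  have "{\<nu> :: 'a \<Rightarrow>\<^sub>0 nat. Poly_Mapping.keys \<nu> \<subseteq> {}} = {0}" by auto
  then show ?case
    using has_sum_finite[of "{0 :: 'a \<Rightarrow>\<^sub>0 nat}" "\<lambda>_. 1 :: 'c"] by auto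
next
  case (insert b B)
  let ?P = "\<lambda>B \<nu>. \<Prod>b\<in>B. f b (Poly_Mapping.lookup \<nu> b)"
  let ?K = "\<lambda>B. {\<nu> :: 'a \<Rightarrow>\<^sub>0 nat. Poly_Mapping.keys \<nu> \<subseteq> B}"
  have IH: "(\<lambda>\<nu>. norm (?P B \<nu>)) summable_on ?K B" "(?P B has_sum (\<Prod>b\<in>B. s b)) (?K B)"
    using insert.IH insert.prems by auto
  have eq: "?P (insert b B) (case x of (\<nu>, n) \<Rightarrow> \<nu> + Poly_Mapping.single b n)
      = (case x of (\<nu>, n) \<Rightarrow> ?P B \<nu> * f b n)" if "x \<in> ?K B \<times> UNIV" for x
  proof -
    obtain \<nu> n where x: "x = (\<nu>, n)" by force
    have "Poly_Mapping.lookup \<nu> b = 0" using that x insert.hyps in_keys_iff[of b \<nu>] by auto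
    moreover have "?P B (\<nu> + Poly_Mapping.single b n) = ?P B \<nu>"
      using insert.hyps by (intro prod.cong refl) (auto simp: lookup_add lookup_single when_def)
    ultimately show ?thesis using insert.hyps x by (simp add: lookup_add mult.commute)
  qed
  have "(\<lambda>x. norm (case x of (\<nu>, n) \<Rightarrow> ?P B \<nu> * f b n)) summable_on ?K B \<times> UNIV"
    using abs_summable_mult_Times[OF IH(1)] insert.prems by auto
  then have "(\<lambda>x. norm (?P (insert b B) (case x of (\<nu>, n) \<Rightarrow> \<nu> + Poly_Mapping.single b n)))
      summable_on ?K B \<times> UNIV"
    by (subst summable_on_cong[where g = "\<lambda>x. norm (case x of (\<nu>, n) \<Rightarrow> ?P B \<nu> * f b n)"])
      (auto simp: eq)
  then have 1: "(\<lambda>\<nu>. norm (?P (insert b B) \<nu>)) summable_on ?K (insert b B)"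
    using summable_on_reindex_bij_betw[OF bij_betw_add_single[OF insert.hyps(2)],
        of "\<lambda>\<nu>. norm (?P (insert b B) \<nu>)"] by simp
  have "((\<lambda>x. case x of (\<nu>, n) \<Rightarrow> ?P B \<nu> * f b n) has_sum ((\<Prod>b\<in>B. s b) * s b)) (?K B \<times> UNIV)"
    using insert.prems by (intro has_sum_mult_Times IH) auto
  then have "((\<lambda>x. ?P (insert b B) (case x of (\<nu>, n) \<Rightarrow> \<nu> + Poly_Mapping.single b n))
      has_sum ((\<Prod>b\<in>B. s b) * s b)) (?K B \<times> UNIV)"
    by (subst has_sum_cong[where g = "\<lambda>x. case x of (\<nu>, n) \<Rightarrow> ?P B \<nu> * f b n"]) (auto simp: eq)
  then have "(?P (insert b B) has_sum ((\<Prod>b\<in>B. s b) * s b)) (?K (insert b B))"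
    using has_sum_reindex_bij_betw[OF bij_betw_add_single[OF insert.hyps(2)],
        of "?P (insert b B)"] by simp
  with 1 show ?case using insert.hyps by (simp add: mult.commute)
qed

lemma blinfun_apply_Basis_sum:
  "blinfun_apply (f :: 'v::euclidean_space \<Rightarrow>\<^sub>L 'b::real_normed_vector) v
     = (\<Sum>b\<in>Basis. (v \<bullet> b) *\<^sub>R blinfun_apply f b)"
  by (metis (no_types, lifting) blinfun.scaleR_right blinfun.sum_right euclidean_representation
      sum.cong)

lemma exp_abs_summable: "(\<lambda>n. norm (z ^ n /\<^sub>R fact n)) summable_on UNIV" for z :: complex
  using summable_norm_exp[of z] summable_on_UNIV_nonneg_real_iff[of "\<lambda>n. norm (z ^ n /\<^sub>R fact n)"]
  by simp

lemma exp_has_sum: "((\<lambda>n. z ^ n /\<^sub>R fact n) has_sum exp z) UNIV" for z :: complex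
  using norm_summable_imp_has_sum[OF summable_norm_exp exp_converges[of z]] by simp

text \<open>By additivity of \<mu>, \<open>cexp \<mu> (x + h)\<close> is \<open>cexp \<mu> x\<close>
  times one exponential for each coordinate of \<open>h\<close>, and the one-variable series
  multiply to a power series. It converges for every \<open>h\<close>; the radius 1 is an arbitrary
  choice.\<close>

lemma cexp_real_analytic: "cexp \<mu> \<in> real_analytic"
  unfolding real_analytic_def mem_Collect_eq
proof (intro allI exI[of _ 1] conjI)
  fix x :: 'a
  let ?c = "\<lambda>\<nu>. cexp \<mu> x * (\<Prod>b\<in>Basis. blinfun_apply \<mu> b ^ Poly_Mapping.lookup \<nu> b
      /\<^sub>R fact (Poly_Mapping.lookup \<nu> b))"
  show "\<exists>c :: ('a \<Rightarrow>\<^sub>0 nat) \<Rightarrow> complex. \<forall>h. norm h < 1 \<longrightarrow>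
        ((\<lambda>\<nu>. c \<nu> * of_real (\<Prod>b\<in>Basis. (h \<bullet> b) ^ Poly_Mapping.lookup \<nu> b))
           has_sum cexp \<mu> (x + h)) {\<nu>. Poly_Mapping.keys \<nu> \<subseteq> Basis}"
  proof (intro exI[of _ ?c] allI impI)
    fix h :: 'a
    let ?z = "\<lambda>b. blinfun_apply \<mu> b * of_real (h \<bullet> b)"
    have "((\<lambda>\<nu>. \<Prod>b\<in>Basis. ?z b ^ Poly_Mapping.lookup \<nu> b /\<^sub>R fact (Poly_Mapping.lookup \<nu> b))
        has_sum (\<Prod>b\<in>Basis. exp (?z b))) {\<nu>. Poly_Mapping.keys \<nu> \<subseteq> Basis}"
      using has_sum_prod_poly_mapping[where B = "Basis :: 'a set" and
          f = "\<lambda>b n. ?z b ^ n /\<^sub>R fact n" and s = "\<lambda>b. exp (?z b)"]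
        exp_abs_summable exp_has_sum by simp
    then have "((\<lambda>\<nu>. cexp \<mu> x *
          (\<Prod>b\<in>Basis. ?z b ^ Poly_Mapping.lookup \<nu> b /\<^sub>R fact (Poly_Mapping.lookup \<nu> b)))
        has_sum cexp \<mu> x * (\<Prod>b\<in>Basis. exp (?z b))) {\<nu>. Poly_Mapping.keys \<nu> \<subseteq> Basis}"
      by (rule has_sum_cmult_right)
    moreover have "cexp \<mu> x * (\<Prod>b\<in>Basis. exp (?z b)) = cexp \<mu> (x + h)"
      by (simp add: cexp_def exp_sum[symmetric] blinfun.add_right exp_add
          blinfun_apply_Basis_sum[of \<mu> h] scaleR_conv_of_real mult.commute)
    moreover have "cexp \<mu> x *
          (\<Prod>b\<in>Basis. ?z b ^ Poly_Mapping.lookup \<nu> b /\<^sub>R fact (Poly_Mapping.lookup \<nu> b))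
        = ?c \<nu> * of_real (\<Prod>b\<in>Basis. (h \<bullet> b) ^ Poly_Mapping.lookup \<nu> b)" for \<nu>
      by (simp add: power_mult_distrib prod.distrib prod_dividef scaleR_conv_of_real mult_ac)
    ultimately show "((\<lambda>\<nu>. ?c \<nu> * of_real (\<Prod>b\<in>Basis. (h \<bullet> b) ^ Poly_Mapping.lookup \<nu> b))
           has_sum cexp \<mu> (x + h)) {\<nu>. Poly_Mapping.keys \<nu> \<subseteq> Basis}"
      by simp
  qed
qed simp

section \<open>Exponentials as eigenfunctions of constant coefficient operators\<close>

text \<open>The constant \<open>c\<close> is there for the iteration: a derivative of an exponential
  is a multiple of it, to which the next derivative is applied.\<close>

lemma dir_deriv_cmult_cexp:
  "dir_deriv b (\<lambda>x. c * cexp \<mu> x) = (\<lambda>x. (blinfun_apply \<mu> b * c) * cexp \<mu> x)"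
proof
  fix x
  have "((\<lambda>t. c * cexp \<mu> (x + t *\<^sub>R b)) has_vector_derivative
      (blinfun_apply \<mu> b * c) * cexp \<mu> x) (at 0)"
    unfolding cexp_def blinfun.add_right blinfun.scaleR_right scaleR_conv_of_real
    by (rule has_vector_derivative_real_field) (auto intro!: derivative_eq_intros)
  then show "dir_deriv b (\<lambda>x. c * cexp \<mu> x) x = (blinfun_apply \<mu> b * c) * cexp \<mu> x"
    unfolding dir_deriv_def by (rule vector_derivative_at)
qed

lemma dir_deriv_funpow_cexp:
  "(dir_deriv b ^^ n) (\<lambda>x. c * cexp \<mu> x) = (\<lambda>x. (blinfun_apply \<mu> b ^ n * c) * cexp \<mu> x)"
proof (induction n)
  case (Suc n)
  then show ?case by (simp add: dir_deriv_cmult_cexp) (simp add: mult.assoc)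
qed simp

lemma basis_list: "set basis_list = (Basis :: 'v::euclidean_space set)"
  "distinct (basis_list :: 'v list)"
  using someI_ex[OF finite_distinct_list[OF finite_Basis[where 'a = 'v]]]
  unfolding basis_list_def by auto

lemma mono_deriv_cexp:
  "mono_deriv \<nu> (cexp \<mu>) =
     (\<lambda>x. (\<Prod>b\<in>Basis. blinfun_apply \<mu> b ^ Poly_Mapping.lookup \<nu> b) * cexp \<mu> x)"
proof -
  have "foldr (\<lambda>b. dir_deriv b ^^ Poly_Mapping.lookup \<nu> b) bs (cexp \<mu>) =
      (\<lambda>x. (\<Prod>b\<in>set bs. blinfun_apply \<mu> b ^ Poly_Mapping.lookup \<nu> b) * cexp \<mu> x)"
    if "distinct bs" for bs
    using that by (induction bs) (simp_all add: dir_deriv_funpow_cexp)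
  from this[OF basis_list(2)] show ?thesis
    unfolding mono_deriv_def basis_list(1) .
qed

lemma sym_diff_cexp: "sym_diff p (cexp \<mu>) = (\<lambda>x. sym_eval p \<mu> * cexp \<mu> x)"
  by (simp add: sym_diff_def sym_eval_def mono_deriv_cexp sum_distrib_right mult.assoc)

text \<open>Keys can cancel in a sum of polynomials, so additivity is proved over a common finite
  index set on which missing coefficients are 0.\<close>

lemma sym_eval_superset:
  assumes "finite S" "Poly_Mapping.keys p \<subseteq> S"
  shows "sym_eval p \<mu> = (\<Sum>\<nu>\<in>S. Poly_Mapping.lookup p \<nu> *
        (\<Prod>b\<in>Basis. blinfun_apply \<mu> b ^ Poly_Mapping.lookup \<nu> b))"
  unfolding sym_eval_def using assms
  by (intro sum.mono_neutral_left) (auto simp: in_keys_iff)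

lemma sym_eval_add: "sym_eval (p + q) \<mu> = sym_eval p \<mu> + sym_eval q \<mu>"
proof -
  let ?S = "Poly_Mapping.keys p \<union> Poly_Mapping.keys q"
  have "sym_eval r \<mu> = (\<Sum>\<nu>\<in>?S. Poly_Mapping.lookup r \<nu> *
        (\<Prod>b\<in>Basis. blinfun_apply \<mu> b ^ Poly_Mapping.lookup \<nu> b))" if "r \<in> {p, q, p + q}" for r
    by (rule sym_eval_superset) (use that keys_add[of p q] in auto)
  then show ?thesis by (simp add: lookup_add distrib_right sum.distrib)
qed

lemma sym_eval_0 [simp]: "sym_eval 0 \<mu> = 0"
  by (simp add: sym_eval_def)

lemma sym_eval_sum: "sym_eval (sum f A) \<mu> = (\<Sum>x\<in>A. sym_eval (f x) \<mu>)"
  by (induction A rule: infinite_finite_induct) (simp_all add: sym_eval_add)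

lemma sym_eval_single:
  "sym_eval (Poly_Mapping.single \<nu> c) \<mu> =
     c * (\<Prod>b\<in>Basis. blinfun_apply \<mu> b ^ Poly_Mapping.lookup \<nu> b)"
  by (subst sym_eval_superset[of "{\<nu>}"]) auto

lemma poly_mapping_sum_single:
  "p = (\<Sum>\<nu>\<in>Poly_Mapping.keys p. Poly_Mapping.single \<nu> (Poly_Mapping.lookup p \<nu>))"
proof (rule poly_mapping_eqI)
  fix x
  show "Poly_Mapping.lookup p x = Poly_Mapping.lookup
      (\<Sum>\<nu>\<in>Poly_Mapping.keys p. Poly_Mapping.single \<nu> (Poly_Mapping.lookup p \<nu>)) x"
    by (auto simp: lookup_sum lookup_single when_def in_keys_iff)
qed

lemma sym_eval_mult: "sym_eval (p * q) \<mu> = sym_eval p \<mu> * sym_eval q \<mu>"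
proof -
  have "p * q = (\<Sum>\<nu>\<in>Poly_Mapping.keys p. Poly_Mapping.single \<nu> (Poly_Mapping.lookup p \<nu>)) *
      (\<Sum>\<nu>\<in>Poly_Mapping.keys q. Poly_Mapping.single \<nu> (Poly_Mapping.lookup q \<nu>))"
    using poly_mapping_sum_single[of p] poly_mapping_sum_single[of q] by simp
  then show ?thesis
    by (simp add: sum_product mult_single sym_eval_sum sym_eval_single sym_eval_def[of p]
        sym_eval_def[of q] lookup_add power_add prod.distrib mult_ac)
qed

lemma sym_eval_1 [simp]: "sym_eval 1 \<mu> = 1"
  using sym_eval_single[of 0 1 \<mu>] by (simp add: single_one[symmetric] del: single_one)

lemma sym_eval_power: "sym_eval (p ^ n) \<mu> = sym_eval p \<mu> ^ n"
  by (induction n) (simp_all add: sym_eval_mult)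

lemma sym_eval_prod: "sym_eval (prod f A) \<mu> = (\<Prod>x\<in>A. sym_eval (f x) \<mu>)"
  by (induction A rule: infinite_finite_induct) (simp_all add: sym_eval_mult)

lemma sym_eval_vec: "sym_eval (sym_vec v) \<mu> = blinfun_apply \<mu> v"
proof -
  have "(\<Prod>c\<in>Basis. blinfun_apply \<mu> c ^ Poly_Mapping.lookup (Poly_Mapping.single b 1) c)
      = blinfun_apply \<mu> b" if "b \<in> Basis" for b
  proof -
    have "(\<Prod>c\<in>Basis. blinfun_apply \<mu> c ^ Poly_Mapping.lookup (Poly_Mapping.single b 1) c)
        = (\<Prod>c\<in>Basis. if c = b then blinfun_apply \<mu> b else 1)"
      by (intro prod.cong refl) (auto simp: lookup_single when_def)
    then show ?thesis using that by simp
  qed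
  then show ?thesis
    by (simp add: sym_vec_def sym_eval_sum sym_eval_single blinfun_apply_Basis_sum[of \<mu> v]
        scaleR_conv_of_real)
qed

text \<open>\<open>sym_act w\<close> substitutes the linear form of \<open>w b\<close> for the
  variable \<open>b\<close>, and evaluation at \<mu> turns this form into the value of \<mu> at
  \<open>w b\<close>. For invariant \<open>p\<close> it follows that \<open>sym_eval p\<close> is
  constant on Weyl orbits, which puts all exponentials of the orbit into
  \<open>E_space\<close>.\<close>

lemma sym_eval_act:
  assumes "\<And>b. b \<in> Basis \<Longrightarrow> blinfun_apply \<mu>' b = blinfun_apply \<mu> (w b)"
  shows "sym_eval (sym_act w p) \<mu> = sym_eval p \<mu>'"
  by (simp add: sym_act_def sym_eval_sum sym_eval_mult sym_eval_single sym_eval_prod sym_eval_power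
      sym_eval_vec assms sym_eval_def[of p])

section \<open>Independence of exponentials\<close>

text \<open>Complex \<open>exp\<close> is not injective, so the functionals are recovered from the
  derivatives at 0 and not from the values.\<close>

lemma cexp_eq_imp_eq:
  assumes "cexp \<mu> = cexp \<nu>"
  shows "\<mu> = \<nu>"
proof (rule blinfun_eqI)
  fix v
  have "(\<lambda>x. 1 * cexp \<mu> x) = (\<lambda>x. 1 * cexp \<nu> x)" using assms by simp
  then have "dir_deriv v (\<lambda>x. 1 * cexp \<mu> x) 0 = dir_deriv v (\<lambda>x. 1 * cexp \<nu> x) 0"
    by metis
  then show "blinfun_apply \<mu> v = blinfun_apply \<nu> v"
    unfolding dir_deriv_cmult_cexp by (simp add: cexp_def blinfun.zero_right)
qed

text \<open>Artin's argument for the independence of characters, with coefficients in \<open>M\<close>.\<close>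

lemma cexp_independent:
  fixes sm :: "complex \<Rightarrow> 'm::ab_group_add \<Rightarrow> 'm"
  assumes M: "vector_space sm" and "finite I" "inj_on \<mu> I"
    and "\<And>v. (\<Sum>i\<in>I. sm (cexp (\<mu> i) v) (n i)) = 0" and "i \<in> I"
  shows "n i = 0"
proof -
  interpret M: vector_space sm by (rule M)
  \<comment> \<open>The coefficients \<open>n\<close> stay quantified because the induction
    hypothesis is applied to rescaled ones.\<close>
  have "\<forall>n. (\<forall>v. (\<Sum>i\<in>I. sm (cexp (\<mu> i) v) (n i)) = 0) \<longrightarrow> (\<forall>i\<in>I. n i = 0)"
    using assms(2,3)
  proof (induction I rule: finite_induct)
    case empty
    then show ?case by simp
  next
    case (insert j I)
    have inj: "inj_on \<mu> I" using insert.prems by simp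
    show ?case
    proof (intro allI impI)
      fix n assume *: "\<forall>v. (\<Sum>i\<in>insert j I. sm (cexp (\<mu> i) v) (n i)) = 0"
      have c_add: "cexp (\<mu> i) (v + u) = cexp (\<mu> i) v * cexp (\<mu> i) u" for i u v
        by (simp add: cexp_def blinfun.add_right exp_add)
      \<comment> \<open>From the relation at \<open>v + u\<close>, subtract
        \<open>cexp (\<mu> j) u\<close> times the relation at \<open>v\<close>: the term of
        \<open>j\<close> cancels.\<close>
      have "(\<Sum>i\<in>I. sm (cexp (\<mu> i) v) (sm (cexp (\<mu> i) u - cexp (\<mu> j) u) (n i))) = 0" for u v
      proof -
        have "0 = (\<Sum>i\<in>insert j I. sm (cexp (\<mu> i) (v + u)) (n i))
            - sm (cexp (\<mu> j) u) (\<Sum>i\<in>insert j I. sm (cexp (\<mu> i) v) (n i))"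
          using * by simp
        also have "\<dots> = (\<Sum>i\<in>insert j I. sm (cexp (\<mu> i) v) (sm (cexp (\<mu> i) u - cexp (\<mu> j) u) (n i)))"
          by (simp only: M.scale_sum_right sum_subtractf[symmetric] M.scale_scale c_add
              M.scale_left_diff_distrib[symmetric]) (simp add: algebra_simps)
        finally show ?thesis using insert.hyps by simp
      qed
      then have d: "sm (cexp (\<mu> i) u - cexp (\<mu> j) u) (n i) = 0" if "i \<in> I" for i u
        using insert.IH[OF inj, THEN spec, of "\<lambda>i. sm (cexp (\<mu> i) u - cexp (\<mu> j) u) (n i)"]
          that by blast
      have n0: "n i = 0" if "i \<in> I" for i
      proof -
        have "\<mu> i \<noteq> \<mu> j" using that insert.prems insert.hyps by (auto simp: inj_on_def)
        then obtain u where "cexp (\<mu> i) u \<noteq> cexp (\<mu> j) u" using cexp_eq_imp_eq by blast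
        with d[OF that, of u] show ?thesis by simp
      qed
      have "sm (cexp (\<mu> j) 0) (n j) = 0" using spec[OF *, of 0] insert.hyps n0 by simp
      then show "\<forall>i\<in>insert j I. n i = 0" using n0 by (simp add: cexp_def blinfun.zero_right)
    qed
  qed
  with assms show ?thesis by blast
qed

section \<open>The finite Weyl group\<close>

text \<open>Precomposition with \<open>w\<close> itself, for values in any normed space: it serves
  real roots and complex functionals alike and avoids the inverse in \<open>dual_act\<close>. It
  reverses the order of composition.\<close>

definition pull :: "('v::euclidean_space \<Rightarrow> 'v) \<Rightarrow> ('v \<Rightarrow>\<^sub>L 'b::real_normed_vector) \<Rightarrow> ('v \<Rightarrow>\<^sub>L 'b)" where
  "pull w \<mu> = Blinfun (\<lambda>v. blinfun_apply \<mu> (w v))"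

lemma pull_apply:
  assumes "linear w"
  shows "blinfun_apply (pull w \<mu>) v = blinfun_apply \<mu> (w v)"
proof -
  have "bounded_linear (\<lambda>v. blinfun_apply \<mu> (w v))"
    using bounded_linear_compose[OF blinfun.bounded_linear_right
        linear_conv_bounded_linear[THEN iffD1, OF assms]] .
  then show ?thesis by (simp add: pull_def bounded_linear_Blinfun_apply)
qed

lemma dual_act_eq_pull: "dual_act w \<mu> = pull (inv w) \<mu>"
  by (simp add: dual_act_def pull_def)

lemma pull_id [simp]: "pull id \<mu> = \<mu>"
  by (simp add: pull_def blinfun_apply_inverse)

lemma pull_pull:
  "linear u \<Longrightarrow> linear w \<Longrightarrow> pull u (pull w \<mu>) = pull (w \<circ> u) \<mu>"
  by (rule blinfun_eqI) (simp add: pull_apply linear_compose)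

definition riesz :: "('v::euclidean_space \<Rightarrow>\<^sub>L real) \<Rightarrow> 'v" where
  "riesz \<xi> = (\<Sum>b\<in>Basis. blinfun_apply \<xi> b *\<^sub>R b)"

lemma inner_riesz: "riesz \<xi> \<bullet> v = blinfun_apply \<xi> v"
  by (simp add: riesz_def inner_sum_left blinfun_apply_Basis_sum[of \<xi> v] inner_commute[of v]
      mult.commute)

lemma dual_inner_riesz: "dual_inner \<xi> \<eta> = riesz \<xi> \<bullet> riesz \<eta>"
  by (simp add: inner_riesz riesz_def[of \<eta>] blinfun.sum_right blinfun.scaleR_right dual_inner_def
      mult.commute)

lemma riesz_eq_0_iff [simp]: "riesz \<xi> = 0 \<longleftrightarrow> \<xi> = 0"
  by (metis blinfun_eqI inner_eq_zero_iff inner_riesz inner_zero_left zero_blinfun.rep_eq)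

lemma dual_inner_pos: "\<xi> \<noteq> 0 \<Longrightarrow> dual_inner \<xi> \<xi> > 0"
  by (simp add: dual_inner_riesz)

text \<open>Uniqueness holds because the functionals \<open>blinfun_inner_right v\<close> separate
  points. At \<open>\<xi> = 0\<close> division by zero makes both sides 0.\<close>

lemma coroot_eq: "coroot \<xi> = (2 / dual_inner \<xi> \<xi>) *\<^sub>R riesz \<xi>"
  unfolding coroot_def
proof (rule the_equality)
  have eq: "blinfun_apply \<eta> ((2 / dual_inner \<xi> \<xi>) *\<^sub>R riesz \<xi>) = 2 * dual_inner \<eta> \<xi> / dual_inner \<xi> \<xi>"
    for \<eta>
    by (simp add: blinfun.scaleR_right dual_inner_riesz inner_riesz)
  then show "\<forall>\<eta>. blinfun_apply \<eta> ((2 / dual_inner \<xi> \<xi>) *\<^sub>R riesz \<xi>) =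
      2 * dual_inner \<eta> \<xi> / dual_inner \<xi> \<xi>" by blast
  fix x assume x: "\<forall>\<eta>. blinfun_apply \<eta> x = 2 * dual_inner \<eta> \<xi> / dual_inner \<xi> \<xi>"
  have "v \<bullet> x = v \<bullet> ((2 / dual_inner \<xi> \<xi>) *\<^sub>R riesz \<xi>)" for v
    using trans[OF x[rule_format, of "blinfun_inner_right v"] eq[symmetric]] by simp
  then show "x = (2 / dual_inner \<xi> \<xi>) *\<^sub>R riesz \<xi>"
    by (intro vector_eq_ldot[THEN iffD1]) blast
qed

lemma apply_coroot: "blinfun_apply \<eta> (coroot \<xi>) = 2 * dual_inner \<eta> \<xi> / dual_inner \<xi> \<xi>"
  by (simp add: coroot_eq blinfun.scaleR_right dual_inner_riesz inner_riesz)

lemma apply_coroot_self: "\<xi> \<noteq> 0 \<Longrightarrow> blinfun_apply \<xi> (coroot \<xi>) = 2"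
  using dual_inner_pos[of \<xi>] by (simp add: apply_coroot)

lemma riesz_minus: "riesz (- \<xi>) = - riesz \<xi>"
  by (simp add: riesz_def sum_negf uminus_blinfun.rep_eq)

lemma coroot_minus: "coroot (- \<xi>) = - coroot \<xi>"
  by (simp add: coroot_eq dual_inner_riesz riesz_minus)

lemma inner_coroot: "coroot \<xi> \<bullet> v = 2 / dual_inner \<xi> \<xi> * blinfun_apply \<xi> v"
  by (simp add: coroot_eq inner_riesz)

lemma root_refl_minus [simp]: "root_refl (- \<alpha>) = root_refl \<alpha>"
  by (rule ext) (simp add: root_refl_def coroot_minus uminus_blinfun.rep_eq)

lemma linear_root_refl: "linear (root_refl \<alpha>)"
  by (rule linearI)
    (simp_all add: root_refl_def blinfun.add_right blinfun.scaleR_right algebra_simps)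

lemma root_refl_invol:
  assumes "\<alpha> \<noteq> 0"
  shows "root_refl \<alpha> (root_refl \<alpha> v) = v"
  by (simp add: root_refl_def blinfun.diff_right blinfun.scaleR_right apply_coroot_self[OF assms]
      algebra_simps flip: scaleR_2)

lemma root_refl_comp_self: "\<alpha> \<noteq> 0 \<Longrightarrow> root_refl \<alpha> \<circ> root_refl \<alpha> = id"
  by (rule ext) (simp add: root_refl_invol)

lemma inv_root_refl: "\<alpha> \<noteq> 0 \<Longrightarrow> inv (root_refl \<alpha>) = root_refl \<alpha>"
  using root_refl_comp_self inv_unique_comp by blast

lemma root_refl_isometry:
  assumes "\<alpha> \<noteq> 0"
  shows "root_refl \<alpha> u \<bullet> root_refl \<alpha> v = u \<bullet> v"
proof -
  show ?thesis
    using dual_inner_pos[OF assms]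
    by (simp add: root_refl_def inner_diff_left inner_diff_right inner_coroot
        inner_commute[of u "coroot \<alpha>"] apply_coroot_self[OF assms] field_simps)
qed

lemma pull_root_refl:
  "pull (root_refl \<alpha>) \<beta> = \<beta> - blinfun_apply \<beta> (coroot \<alpha>) *\<^sub>R (\<alpha> :: 'v::euclidean_space \<Rightarrow>\<^sub>L real)"
  by (rule blinfun_eqI)
    (simp add: pull_apply[OF linear_root_refl] root_refl_def blinfun.diff_right blinfun.scaleR_right
      minus_blinfun.rep_eq scaleR_blinfun.rep_eq)

lemma apply_root_refl: 
  "blinfun_apply \<beta> (root_refl \<alpha> v) =
     blinfun_apply (\<beta> - blinfun_apply \<beta> (coroot \<alpha>) *\<^sub>R \<alpha>) v"
  for \<beta> :: "'v::euclidean_space \<Rightarrow>\<^sub>L real"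
  using pull_apply[OF linear_root_refl, of \<alpha> \<beta> v] by (simp add: pull_root_refl)

lemma nat_comb_nonneg:
  assumes "\<gamma> \<in> nat_comb F" "\<And>\<beta>. \<beta> \<in> F \<Longrightarrow> blinfun_apply \<beta> v \<ge> 0"
  shows "blinfun_apply \<gamma> v \<ge> 0"
  using assms
  by (auto simp: nat_comb_def blinfun.sum_left scaleR_blinfun.rep_eq intro!: sum_nonneg)

lemma nat_comb_pos:
  assumes "finite F" "\<gamma> \<in> nat_comb F" "\<And>\<beta>. \<beta> \<in> F \<Longrightarrow> blinfun_apply \<beta> v > 0" "\<gamma> \<noteq> 0"
  shows "blinfun_apply \<gamma> v > 0"
proof -
  obtain c where c: "\<gamma> = (\<Sum>\<beta>\<in>F. of_nat (c \<beta>) *\<^sub>R \<beta>)" using assms(2) by (auto simp: nat_comb_def)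
  obtain \<beta> where \<beta>: "\<beta> \<in> F" "c \<beta> > 0"
    using assms(4) c
    by (metis (no_types, lifting) bot_nat_0.not_eq_extremum of_nat_0 scaleR_eq_0_iff
        sum.neutral)
  have nn: "\<beta> \<in> F \<Longrightarrow> blinfun_apply \<beta> v \<ge> 0" for \<beta> using assms(3) less_imp_le by blast
  show ?thesis
    unfolding c blinfun.sum_left scaleR_blinfun.rep_eq
    by (rule sum_pos2[OF assms(1) \<beta>(1)]) (use assms(3) nn \<beta> in auto)
qed

section \<open>The Weyl group and its finiteness\<close>

locale finite_roots =
  fixes R :: "('v::euclidean_space \<Rightarrow>\<^sub>L real) set"
  assumes root_system: "root_system R"
begin

lemma finite_R: "finite R" and zero_notin_R: "0 \<notin> R"
  and refl_image: "\<alpha> \<in> R \<Longrightarrow> (\<lambda>\<beta>. \<beta> - blinfun_apply \<beta> (coroot \<alpha>) *\<^sub>R \<alpha>) ` R = R"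
  using root_system by (auto simp: root_system_def)

lemma root_nonzero: "\<alpha> \<in> R \<Longrightarrow> \<alpha> \<noteq> 0"
  using zero_notin_R by blast

lemma refl_in_R: "\<alpha> \<in> R \<Longrightarrow> \<beta> \<in> R \<Longrightarrow> \<beta> - blinfun_apply \<beta> (coroot \<alpha>) *\<^sub>R \<alpha> \<in> R"
  using refl_image by blast

lemma minus_in_R: "\<alpha> \<in> R \<Longrightarrow> - \<alpha> \<in> R"
  using refl_in_R[of \<alpha> \<alpha>] apply_coroot_self[OF root_nonzero, of \<alpha>] by (simp add: scaleR_2)

lemma root_refl_in_weyl: "\<alpha> \<in> R \<Longrightarrow> root_refl \<alpha> \<in> weyl R"
  using weyl.weyl_refl[OF weyl.weyl_id] by fastforce

text \<open>\<open>weyl.induct\<close> states its cases with expanded compositions, which the simplifier cannot refold.\<close>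

lemma weyl_induct [consumes 1, case_names id refl]:
  assumes "w \<in> weyl R" "P id"
    "\<And>w \<alpha>. w \<in> weyl R \<Longrightarrow> P w \<Longrightarrow> \<alpha> \<in> R \<Longrightarrow> P (root_refl \<alpha> \<circ> w)"
  shows "P w"
  using assms(1)
proof (induction rule: weyl.induct)
  case weyl_id
  then show ?case using assms(2) by (simp only: id_def)
next
  case (weyl_refl w \<alpha>)
  then show ?case using assms(3) by (simp only: comp_def)
qed

lemma weyl_comp: "u \<in> weyl R \<Longrightarrow> w \<in> weyl R \<Longrightarrow> u \<circ> w \<in> weyl R"
  by (induction u rule: weyl_induct) (auto simp: comp_assoc intro: weyl.intros)

lemma weyl_linear: "w \<in> weyl R \<Longrightarrow> linear w"
  by (induction w rule: weyl_induct)
    (blast intro: linear_id linear_compose linear_root_refl)+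

lemma weyl_isometry: "w \<in> weyl R \<Longrightarrow> w u \<bullet> w v = u \<bullet> v"
  by (induction w arbitrary: u v rule: weyl_induct) (auto simp: root_refl_isometry root_nonzero)

lemma weyl_left_inverse: "w \<in> weyl R \<Longrightarrow> \<exists>u\<in>weyl R. u \<circ> w = id \<and> w \<circ> u = id"
proof (induction w rule: weyl_induct)
  case id
  then show ?case using weyl.weyl_id[of R] by (intro bexI[of _ id]) simp_all
next
  case (refl w \<alpha>)
  then obtain u where u: "u \<in> weyl R" "u \<circ> w = id" "w \<circ> u = id" by blast
  have s: "root_refl \<alpha> \<circ> root_refl \<alpha> = id"
    using root_refl_comp_self root_nonzero refl by blast
  have "(u \<circ> root_refl \<alpha>) \<circ> (root_refl \<alpha> \<circ> w) = id"
    using u(2) s by (metis comp_assoc comp_id)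
  moreover have "(root_refl \<alpha> \<circ> w) \<circ> (u \<circ> root_refl \<alpha>) = id"
    using u(3) s by (metis comp_assoc comp_id)
  ultimately show ?case
    using weyl_comp[OF u(1) root_refl_in_weyl[OF refl.hyps(2)]] by blast
qed

lemma weyl_bij: "w \<in> weyl R \<Longrightarrow> bij w"
  using weyl_left_inverse o_bij by blast

lemma weyl_inv: "w \<in> weyl R \<Longrightarrow> inv w \<in> weyl R"
  using weyl_left_inverse inv_unique_comp by metis

lemma weyl_inv_apply [simp]: "w \<in> weyl R \<Longrightarrow> inv w (w v) = v" "w \<in> weyl R \<Longrightarrow> w (inv w v) = v"
  using weyl_bij by (auto simp: bij_is_inj bij_is_surj surj_f_inv_f)

lemma pull_in_R: "w \<in> weyl R \<Longrightarrow> \<alpha> \<in> R \<Longrightarrow> pull w \<alpha> \<in> R"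
proof (induction w arbitrary: \<alpha> rule: weyl_induct)
  case (refl w \<beta>)
  then show ?case
    using refl_in_R[of \<beta> \<alpha>] pull_pull[OF weyl_linear linear_root_refl, of w \<beta> \<alpha>]
    unfolding pull_root_refl by metis
qed simp

lemma apply_pull: "w \<in> weyl R \<Longrightarrow> blinfun_apply (pull w \<mu>) v = blinfun_apply \<mu> (w v)"
  by (simp add: pull_apply weyl_linear)

text \<open>An isometry carries the Riesz vector of \<open>pull w \<alpha>\<close> to that of
  \<open>\<alpha>\<close> and preserves its length, and the coroot is built from these two
  data.\<close>

lemma weyl_coroot_pull:
  assumes "w \<in> weyl R"
  shows "w (coroot (pull w \<alpha>)) = coroot \<alpha>"
proof -
  have r: "w (riesz (pull w \<alpha>)) = riesz \<alpha>"
  proof -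
    have "w (riesz (pull w \<alpha>)) \<bullet> v = riesz \<alpha> \<bullet> v" for v
    proof -
      have "w (riesz (pull w \<alpha>)) \<bullet> w (inv w v) = riesz (pull w \<alpha>) \<bullet> inv w v"
        by (rule weyl_isometry[OF assms])
      also have "\<dots> = riesz \<alpha> \<bullet> v"
        by (simp add: inner_riesz apply_pull assms)
      finally have "w (riesz (pull w \<alpha>)) \<bullet> w (inv w v) = riesz \<alpha> \<bullet> v" .
      then show ?thesis by (simp only: weyl_inv_apply(2)[OF assms])
    qed
    then show ?thesis by (intro vector_eq_rdot[THEN iffD1]) blast
  qed
  have "dual_inner (pull w \<alpha>) (pull w \<alpha>) = dual_inner \<alpha> \<alpha>"
    unfolding dual_inner_riesz using r weyl_isometry[OF assms] by metis
  then show ?thesis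
    by (simp add: coroot_eq linear_scale[OF weyl_linear[OF assms]] r)
qed

text \<open>The conjugation rule for reflections in a form without inverses. It is behind both the
  exchange argument and the reduction of all reflections to simple ones.\<close>

lemma root_refl_weyl:
  assumes "w \<in> weyl R"
  shows "root_refl \<alpha> (w v) = w (root_refl (pull w \<alpha>) v)"
  using assms weyl_coroot_pull[OF assms, of \<alpha>]
  by (simp add: root_refl_def apply_pull linear_diff linear_scale weyl_linear)

lemma weyl_diff_in_span: "w \<in> weyl R \<Longrightarrow> w v - v \<in> span (coroot ` R)"
proof (induction w rule: weyl_induct)
  case (refl w \<alpha>)
  have "(root_refl \<alpha> \<circ> w) v - v = (w v - v) - blinfun_apply \<alpha> (w v) *\<^sub>R coroot \<alpha>"
    by (simp add: root_refl_def)
  also have "\<dots> \<in> span (coroot ` R)"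
    using refl by (intro span_diff[of "w v - v"] span_scale span_base[of "coroot \<alpha>"]) auto
  finally show ?case .
qed (simp add: span_zero)

text \<open>Pulling back roots maps the group into the self-maps of the finite set \<open>R\<close>.
  This is faithful although the roots need not span: if two elements act equally on
  \<open>R\<close>, then the difference of their values at \<open>v\<close> lies in the span of the
  coroots and is killed by every root, hence is orthogonal to itself.\<close>

lemma finite_weyl: "finite (weyl R)"
proof (rule finite_imageD)
  let ?f = "\<lambda>w. restrict (pull w) R"
  show "finite (?f ` weyl R)"
    by (rule finite_subset[OF _ finite_PiE[OF finite_R, of "\<lambda>_. R"]])
      (auto intro: pull_in_R simp: finite_R)
  show "inj_on ?f (weyl R)"
  proof (rule inj_onI, rule ext)
    fix u w v assume uw: "u \<in> weyl R" "w \<in> weyl R" "?f u = ?f w"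
    let ?d = "u v - w v"
    have "pull u \<alpha> = pull w \<alpha>" if "\<alpha> \<in> R" for \<alpha>
      using fun_cong[OF uw(3), of \<alpha>] that by simp
    then have 0: "blinfun_apply \<alpha> ?d = 0" if "\<alpha> \<in> R" for \<alpha>
      using that uw apply_pull by (metis blinfun.diff_right right_minus_eq)
    have "?d = (u v - v) - (w v - v)" by simp
    then have "?d \<in> span (coroot ` R)"
      using weyl_diff_in_span uw by (metis span_diff)
    then have "orthogonal ?d ?d"
      by (rule orthogonal_to_span) (auto simp: orthogonal_def inner_commute inner_coroot 0)
    then show "u v = w v" by (simp add: orthogonal_self)
  qed
qed

end

section \<open>Simple roots and the fundamental alcove\<close>

locale based_roots = finite_roots R for R :: "('v::euclidean_space \<Rightarrow>\<^sub>L real) set" +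
  fixes F :: "('v \<Rightarrow>\<^sub>L real) set" and \<theta> :: "'v \<Rightarrow>\<^sub>L real"
  assumes crystallographic: "crystallographic R" and reduced: "reduced_roots R"
    and basis: "root_basis R F" and highest: "highest_root R F \<theta>"
begin

lemma F_subset: "F \<subseteq> R" and indep_F: "independent F"
  and root_sign: "\<alpha> \<in> R \<Longrightarrow> \<alpha> \<in> nat_comb F \<or> - \<alpha> \<in> nat_comb F"
  using basis by (auto simp: root_basis_def)

lemma finite_F: "finite F"
  using F_subset finite_R finite_subset by blast

lemma theta_in_R: "\<theta> \<in> R" and theta_highest: "\<alpha> \<in> R \<Longrightarrow> \<theta> - \<alpha> \<in> nat_comb F"
  using highest by (auto simp: highest_root_def)

text \<open>Independence of \<open>F\<close> yields a functional equal to 1 on every simple root;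
  the vector representing it, scaled down, is interior to the fundamental alcove.\<close>

lemma ex_alcove_point: "\<exists>c. (\<forall>\<beta>\<in>F. blinfun_apply \<beta> c > 0) \<and> blinfun_apply \<theta> c < 1"
proof -
  obtain f :: "('v \<Rightarrow>\<^sub>L real) \<Rightarrow> real" where f: "linear f" "\<And>\<beta>. \<beta> \<in> F \<Longrightarrow> f \<beta> = 1"
    using linear_independent_extend[OF indep_F, of "\<lambda>_. 1 :: real"] by auto
  \<comment> \<open>The vector that represents \<open>f\<close> under the double dual: its
    coordinates are the values of \<open>f\<close> on the coordinate functionals.\<close>
  define x where "x = (\<Sum>b\<in>Basis. f (blinfun_inner_left b) *\<^sub>R (b :: 'v))"
  have fx: "f \<xi> = blinfun_apply \<xi> x" for \<xi>
  proof -
    have "\<xi> = (\<Sum>b\<in>Basis. blinfun_apply \<xi> b *\<^sub>R blinfun_inner_left b)"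
    proof (rule blinfun_eqI)
      fix v
      show "blinfun_apply \<xi> v =
          blinfun_apply (\<Sum>b\<in>Basis. blinfun_apply \<xi> b *\<^sub>R blinfun_inner_left b) v"
        by (simp add: blinfun.sum_left scaleR_blinfun.rep_eq blinfun_apply_Basis_sum[of \<xi> v]
            mult.commute inner_commute[of v])
    qed
    then have "f \<xi> = f (\<Sum>b\<in>Basis. blinfun_apply \<xi> b *\<^sub>R blinfun_inner_left b)"
      by (rule arg_cong)
    also have "\<dots> = (\<Sum>b\<in>Basis. blinfun_apply \<xi> b * f (blinfun_inner_left b))"
      by (simp add: linear_sum[OF f(1)] linear_scale[OF f(1)])
    finally have "f \<xi> = (\<Sum>b\<in>Basis. blinfun_apply \<xi> b * f (blinfun_inner_left b))" .
    then show ?thesis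
      by (simp add: x_def blinfun.sum_right blinfun.scaleR_right mult.commute)
  qed
  have \<theta>: "blinfun_apply \<theta> x \<ge> 0"
    using nat_comb_nonneg[OF theta_highest[OF minus_in_R[OF theta_in_R]], of x] f(2) fx
    by (simp add: blinfun.add_left)
  \<comment> \<open>As \<theta> is nonnegative at \<open>x\<close>, the summand 1 keeps this factor
    positive and brings the value of \<theta> strictly below 1.\<close>
  let ?t = "1 / (blinfun_apply \<theta> x + 1)"
  show ?thesis
    using \<theta> f(2) fx by (intro exI[of _ "?t *\<^sub>R x"]) (auto simp: blinfun.scaleR_right field_simps)
qed

text \<open>A base point turns positivity of roots and of affine roots into the sign of one number;
  its values also serve as a height function on roots.\<close>

definition alcove_point :: 'v where
  "alcove_point = (SOME x. (\<forall>\<beta>\<in>F. blinfun_apply \<beta> x > 0) \<and> blinfun_apply \<theta> x < 1)"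

lemma simple_alcove_pos: "\<beta> \<in> F \<Longrightarrow> blinfun_apply \<beta> alcove_point > 0"
  and theta_alcove_less_1: "blinfun_apply \<theta> alcove_point < 1"
  using someI_ex[OF ex_alcove_point] by (auto simp: alcove_point_def)

lemma nat_comb_alcove_pos: "\<gamma> \<in> nat_comb F \<Longrightarrow> \<gamma> \<noteq> 0 \<Longrightarrow> blinfun_apply \<gamma> alcove_point > 0"
  using nat_comb_pos[OF finite_F] simple_alcove_pos by blast

lemma root_alcove_nonzero: "\<alpha> \<in> R \<Longrightarrow> blinfun_apply \<alpha> alcove_point \<noteq> 0"
  using root_sign nat_comb_alcove_pos[of \<alpha>] nat_comb_alcove_pos[of "- \<alpha>"] root_nonzero
  by (force simp: uminus_blinfun.rep_eq)

lemma root_pos_iff: "\<alpha> \<in> R \<Longrightarrow> \<alpha> \<in> nat_comb F \<longleftrightarrow> blinfun_apply \<alpha> alcove_point > 0"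
  using root_sign nat_comb_alcove_pos[of \<alpha>] nat_comb_alcove_pos[of "- \<alpha>"] root_nonzero
  by (force simp: uminus_blinfun.rep_eq)

lemma theta_alcove_pos: "blinfun_apply \<theta> alcove_point > 0"
proof -
  have "\<theta> - - \<theta> \<in> nat_comb F" using theta_highest minus_in_R theta_in_R by blast
  moreover have "\<theta> - - \<theta> \<noteq> 0" using root_nonzero[OF theta_in_R]
    by (simp flip: scaleR_2)
  ultimately show ?thesis using nat_comb_alcove_pos[of "\<theta> - - \<theta>"] by (simp add: blinfun.add_left)
qed

lemma root_alcove_le_theta: "\<alpha> \<in> R \<Longrightarrow> blinfun_apply \<alpha> alcove_point \<le> blinfun_apply \<theta> alcove_point"
  using nat_comb_nonneg[OF theta_highest, of \<alpha> alcove_point] simple_alcove_pos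
  by (force simp: minus_blinfun.rep_eq)

lemma root_alcove_less_theta:
  "\<alpha> \<in> R \<Longrightarrow> \<alpha> \<noteq> \<theta> \<Longrightarrow> blinfun_apply \<alpha> alcove_point < blinfun_apply \<theta> alcove_point"
  using nat_comb_alcove_pos[OF theta_highest, of \<alpha>] by (simp add: minus_blinfun.rep_eq)

text \<open>If the reflected root were not positive, then \<beta> and the negative of its reflection
  would both be natural combinations of simple roots whose sum is a multiple of \<alpha>. Natural
  coefficients cannot cancel, so \<beta> would be a multiple of \<alpha>, and reducedness leaves
  only \<alpha> itself.\<close>

lemma simple_refl_pos:
  assumes "\<alpha> \<in> F" "\<beta> \<in> R" "blinfun_apply \<beta> alcove_point > 0" "\<beta> \<noteq> \<alpha>"
  shows "blinfun_apply \<beta> (root_refl \<alpha> alcove_point) > 0"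
proof (rule ccontr)
  assume neg: "\<not> ?thesis"
  let ?N = "blinfun_apply \<beta> (coroot \<alpha>)"
  let ?b = "\<beta> - ?N *\<^sub>R \<alpha>"
  have bR: "?b \<in> R" using refl_in_R assms F_subset by blast
  have "\<not> blinfun_apply ?b alcove_point > 0" using neg by (simp add: apply_root_refl)
  then have "- ?b \<in> nat_comb F" using root_sign[OF bR] root_pos_iff[OF bR] by blast
  then obtain m where m: "- ?b = (\<Sum>\<gamma>\<in>F. of_nat (m \<gamma>) *\<^sub>R \<gamma>)" by (auto simp: nat_comb_def)
  obtain n where n: "\<beta> = (\<Sum>\<gamma>\<in>F. of_nat (n \<gamma>) *\<^sub>R \<gamma>)"
    using assms root_pos_iff[of \<beta>] by (auto simp: nat_comb_def)
  have d: "(\<Sum>\<gamma>\<in>F. (if \<gamma> = \<alpha> then ?N else 0) *\<^sub>R \<gamma>) = ?N *\<^sub>R \<alpha>"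
    using assms finite_F by (simp add: if_distrib[of "\<lambda>x. x *\<^sub>R _"] sum.delta cong: if_cong)
  have "(\<Sum>\<gamma>\<in>F. (of_nat (n \<gamma>) + of_nat (m \<gamma>) - (if \<gamma> = \<alpha> then ?N else 0)) *\<^sub>R \<gamma>)
      = \<beta> + (- ?b) - ?N *\<^sub>R \<alpha>"
    by (subst m, subst (1) n, subst d[symmetric])
      (simp only: scaleR_left_distrib scaleR_left_diff_distrib sum.distrib sum_subtractf)
  then have "(\<Sum>\<gamma>\<in>F. (of_nat (n \<gamma>) + of_nat (m \<gamma>) - (if \<gamma> = \<alpha> then ?N else 0)) *\<^sub>R \<gamma>) = 0"
    by simp
  then have z: "of_nat (n \<gamma>) + of_nat (m \<gamma>) - (if \<gamma> = \<alpha> then ?N else 0) = 0" if "\<gamma> \<in> F" for \<gamma>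
    using independentD[OF indep_F finite_F order_refl _ that,
        of "\<lambda>\<gamma>. of_nat (n \<gamma>) + of_nat (m \<gamma>) - (if \<gamma> = \<alpha> then ?N else 0)"] by blast
  have "n \<gamma> = 0" if "\<gamma> \<in> F - {\<alpha>}" for \<gamma>
    using z[of \<gamma>] that by (simp add: of_nat_add[symmetric] del: of_nat_add)
  then have "\<beta> = of_nat (n \<alpha>) *\<^sub>R \<alpha>"
    unfolding n using sum.remove[OF finite_F assms(1), of "\<lambda>\<gamma>. of_nat (n \<gamma>) *\<^sub>R \<gamma>"] by simp
  moreover from this have "of_nat (n \<alpha>) = (1 :: real) \<or> of_nat (n \<alpha>) = (-1 :: real)"
    using reduced assms F_subset unfolding reduced_roots_def by blast
  then have "of_nat (n \<alpha>) = (1 :: real)" by linarith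
  ultimately show False using assms by simp
qed

section \<open>Words in the simple reflections\<close>

text \<open>The number of letters is kept as an index so that a shortest word can be chosen; words
  are not assumed reduced, and letters are appended on the right.\<close>

primrec simple_word :: "nat \<Rightarrow> ('v \<Rightarrow> 'v) \<Rightarrow> bool" where
  "simple_word 0 w \<longleftrightarrow> w = id"
| "simple_word (Suc n) w \<longleftrightarrow> (\<exists>u. \<exists>\<beta>\<in>F. simple_word n u \<and> w = u \<circ> root_refl \<beta>)"

lemma simple_word_weyl: "simple_word n w \<Longrightarrow> w \<in> weyl R"
proof (induction n arbitrary: w)
  case (Suc n)
  then show ?case using F_subset weyl_comp root_refl_in_weyl unfolding simple_word.simps by blast
qed (simp add: weyl.weyl_id)

lemma simple_word_comp: "simple_word n w \<Longrightarrow> simple_word n' u \<Longrightarrow> simple_word (n' + n) (u \<circ> w)"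
proof (induction n arbitrary: w)
  case (Suc n)
  then obtain v \<beta> where "\<beta> \<in> F" "simple_word n v" "w = v \<circ> root_refl \<beta>" by auto
  moreover from this have "u \<circ> w = (u \<circ> v) \<circ> root_refl \<beta>" by (simp only: o_assoc)
  ultimately show ?case
    using Suc.IH[of v] Suc.prems(2) unfolding add_Suc_right simple_word.simps(2) by blast
qed simp

lemma simple_word_single: "\<beta> \<in> F \<Longrightarrow> simple_word (Suc 0) (root_refl \<beta>)"
  by (auto intro!: exI[of _ id])

lemma simple_word_decomp:
  "simple_word (Suc n) w \<Longrightarrow> \<exists>\<alpha>\<in>F. \<exists>u. simple_word n u \<and> w = root_refl \<alpha> \<circ> u"
proof (induction n arbitrary: w)
  case (Suc n)
  then obtain u \<beta> where u: "simple_word (Suc n) u" "\<beta> \<in> F" "w = u \<circ> root_refl \<beta>"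
    unfolding simple_word.simps(2)[of "Suc n"] by blast
  then obtain \<alpha> u' where "\<alpha> \<in> F" "simple_word n u'" "u = root_refl \<alpha> \<circ> u'"
    using Suc.IH by blast
  moreover from this have "w = root_refl \<alpha> \<circ> (u' \<circ> root_refl \<beta>)" using u(3) by (simp only: comp_assoc)
  ultimately show ?case using u(2) unfolding simple_word.simps(2)[of n] by blast
qed auto

text \<open>
  \<open>\<alpha> \<circ> w\<close> changes sign along the word \<open>w\<close>; the letter at which this happens cancels against
  \<open>root_refl \<alpha>\<close>.
\<close>

lemma exchange:
  assumes "simple_word n w" "\<alpha> \<in> F" "blinfun_apply \<alpha> (w alcove_point) < 0"
  shows "n > 0 \<and> simple_word (n - 1) (root_refl \<alpha> \<circ> w)"
  using assms(1,3)
proof (induction n arbitrary: w)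
  case 0
  then show ?case using simple_alcove_pos[OF assms(2)] by simp
next
  case (Suc n v)
  then obtain w \<beta> where snoc: "simple_word n w" "\<beta> \<in> F" and v: "v = w \<circ> root_refl \<beta>" by auto
  have w: "w \<in> weyl R" using simple_word_weyl snoc by blast
  have \<alpha>R: "\<alpha> \<in> R" using assms(2) F_subset by blast
  show ?case
  proof (cases "blinfun_apply \<alpha> (w alcove_point) < 0")
    case True
    then have "n > 0" "simple_word (n - 1) (root_refl \<alpha> \<circ> w)" using Suc.IH[OF snoc(1) True] by blast+
    then have "simple_word (Suc (n - 1)) ((root_refl \<alpha> \<circ> w) \<circ> root_refl \<beta>)"
      using snoc(2) unfolding simple_word.simps by blast
    then show ?thesis unfolding v using \<open>n > 0\<close> by (simp add: comp_assoc del: comp_apply)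
  next
    case False
    have \<gamma>: "pull w \<alpha> \<in> R" using pull_in_R w \<alpha>R by blast
    have "blinfun_apply (pull w \<alpha>) alcove_point > 0"
      using False root_alcove_nonzero[OF \<gamma>] by (simp add: apply_pull[OF w])
    moreover have "\<not> blinfun_apply (pull w \<alpha>) (root_refl \<beta> alcove_point) > 0"
      using Suc.prems(2) by (simp add: v apply_pull[OF w])
    ultimately have eq: "pull w \<alpha> = \<beta>"
      using simple_refl_pos[OF snoc(2) \<gamma>] by blast
    have "\<beta> \<noteq> 0" using root_nonzero snoc(2) F_subset by blast
    then have "root_refl \<alpha> (w (root_refl \<beta> v)) = w v" for v
      using root_refl_weyl[OF w, of \<alpha>] by (simp add: eq root_refl_invol)
    then have "root_refl \<alpha> \<circ> (w \<circ> root_refl \<beta>) = w"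
      by (intro ext) simp
    then show ?thesis unfolding v using snoc(1) by (simp del: comp_apply)
  qed
qed

text \<open>Let a shortest word begin with the reflection in \<alpha> and let \<open>u\<close> be
  the rest. Positivity of \<alpha> at the image under \<open>w\<close> means negativity at the image
  under \<open>u\<close>, so the exchange argument writes \<open>w\<close> with two letters fewer, a
  contradiction.\<close>

lemma positive_word_id:
  assumes "simple_word n w" "\<And>\<alpha>. \<alpha> \<in> F \<Longrightarrow> blinfun_apply \<alpha> (w alcove_point) > 0"
  shows "w = id"
proof -
  define k where "k = (LEAST n. simple_word n w)"
  have k: "simple_word k w" unfolding k_def using assms(1) by (rule LeastI)
  show ?thesis
  proof (cases k)
    case 0
    then show ?thesis using k by simp
  next
    case (Suc j)
    then obtain \<alpha> u where u: "\<alpha> \<in> F" "simple_word j u" "w = root_refl \<alpha> \<circ> u"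
      using k simple_word_decomp by blast
    have \<alpha>: "\<alpha> \<noteq> 0" using u root_nonzero F_subset by blast
    have "blinfun_apply \<alpha> (root_refl \<alpha> (u alcove_point)) > 0" using assms(2)[OF u(1)] u(3) by simp
    then have "blinfun_apply \<alpha> (u alcove_point) < 0"
      by (simp add: apply_root_refl apply_coroot_self[OF \<alpha>] minus_blinfun.rep_eq scaleR_blinfun.rep_eq)
    then have "simple_word (j - 1) w" using exchange[OF u(2,1)] u(3) by simp
    then have "k \<le> j - 1" unfolding k_def by (rule Least_le)
    then show ?thesis using Suc by simp
  qed
qed

text \<open>Take a counterexample \<beta> of least height. Its inner product with some simple
  \<gamma> is positive, since otherwise its squared length would be at most 0. Reflecting \<beta> in
  \<gamma> gives a lower root that is still positive, because \<beta> is not simple; its reflection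
  is a word, and conjugation by the reflection in \<gamma> returns to \<beta>.\<close>

lemma simple_word_root_refl_pos:
  assumes "\<alpha> \<in> R" "blinfun_apply \<alpha> alcove_point > 0"
  shows "\<exists>n. simple_word n (root_refl \<alpha>)"
proof (rule ccontr)
  assume "\<nexists>n. simple_word n (root_refl \<alpha>)"
  let ?B = "{\<alpha>\<in>R. blinfun_apply \<alpha> alcove_point > 0 \<and> (\<nexists>n. simple_word n (root_refl \<alpha>))}"
  have "finite ?B" "?B \<noteq> {}" using finite_R assms \<open>\<nexists>n. _\<close> by auto
  then obtain \<beta> where \<beta>: "\<beta> \<in> ?B"
    "\<And>\<gamma>. \<gamma> \<in> ?B \<Longrightarrow> blinfun_apply \<beta> alcove_point \<le> blinfun_apply \<gamma> alcove_point"
    using arg_min_least[where S = ?B and f = "\<lambda>\<gamma>. blinfun_apply \<gamma> alcove_point"]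
      arg_min_if_finite(1)[where S = ?B and f = "\<lambda>\<gamma>. blinfun_apply \<gamma> alcove_point"] by blast
  have \<beta>R: "\<beta> \<in> R" "blinfun_apply \<beta> alcove_point > 0" using \<beta> by auto
  have "\<beta> \<notin> F" using \<beta>(1) simple_word_single by blast
  obtain n where n: "\<beta> = (\<Sum>\<gamma>\<in>F. of_nat (n \<gamma>) *\<^sub>R \<gamma>)"
    using \<beta>R root_pos_iff[of \<beta>] by (auto simp: nat_comb_def)
  have "\<exists>\<gamma>\<in>F. dual_inner \<beta> \<gamma> > 0"
  proof (rule ccontr)
    assume *: "\<not> ?thesis"
    have "dual_inner \<beta> \<beta> = blinfun_apply \<beta> (riesz \<beta>)"
      by (simp add: dual_inner_riesz inner_riesz)
    also have "\<dots> = (\<Sum>\<gamma>\<in>F. of_nat (n \<gamma>) * blinfun_apply \<gamma> (riesz \<beta>))"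
      by (subst n) (simp add: blinfun.sum_left scaleR_blinfun.rep_eq)
    also have "\<dots> \<le> 0"
      using * by (intro sum_nonpos mult_nonneg_nonpos)
        (auto simp: dual_inner_riesz inner_riesz[symmetric] inner_commute not_less)
    finally show False using dual_inner_pos[OF root_nonzero[OF \<beta>R(1)]] by simp
  qed
  then obtain \<gamma> where \<gamma>: "\<gamma> \<in> F" "dual_inner \<beta> \<gamma> > 0" by blast
  have \<gamma>R: "\<gamma> \<in> R" using \<gamma> F_subset by blast
  let ?N = "blinfun_apply \<beta> (coroot \<gamma>)"
  let ?\<delta> = "\<beta> - ?N *\<^sub>R \<gamma>"
  have N: "?N > 0" using \<gamma> dual_inner_pos[OF root_nonzero[OF \<gamma>R]] by (simp add: apply_coroot)
  have "blinfun_apply ?\<delta> alcove_point > 0"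
    using simple_refl_pos[OF \<gamma>(1) \<beta>R] \<open>\<beta> \<notin> F\<close> \<gamma>(1) by (metis apply_root_refl)
  moreover have "blinfun_apply ?\<delta> alcove_point < blinfun_apply \<beta> alcove_point"
    using N simple_alcove_pos[OF \<gamma>(1)] by (simp add: minus_blinfun.rep_eq scaleR_blinfun.rep_eq)
  moreover have "?\<delta> \<in> R" using refl_in_R \<gamma>R \<beta>R by blast
  ultimately obtain k where k: "simple_word k (root_refl ?\<delta>)" using \<beta>(2)[of ?\<delta>] by fastforce
  have "root_refl \<beta> = root_refl \<gamma> \<circ> (root_refl ?\<delta> \<circ> root_refl \<gamma>)"
    using root_refl_weyl[OF root_refl_in_weyl[OF \<gamma>R], of \<beta>] root_refl_invol[OF root_nonzero[OF \<gamma>R]]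
    by (auto simp: fun_eq_iff pull_root_refl) metis
  then have "\<exists>n. simple_word n (root_refl \<beta>)"
    using simple_word_comp[OF simple_word_comp[OF simple_word_single k] simple_word_single] \<gamma>(1)
    by metis
  then show False using \<beta>(1) by blast
qed

lemma weyl_simple_word: "w \<in> weyl R \<Longrightarrow> \<exists>n. simple_word n w"
proof (induction w rule: weyl_induct)
  case id
  then show ?case using simple_word.simps(1) by blast
next
  case (refl w \<alpha>)
  have "\<exists>n. simple_word n (root_refl \<alpha>)"
  proof (cases "blinfun_apply \<alpha> alcove_point > 0")
    case False
    then have "blinfun_apply (- \<alpha>) alcove_point > 0"
      using root_alcove_nonzero[OF refl.hyps(2)] by (simp add: uminus_blinfun.rep_eq)
    then show ?thesis
      using simple_word_root_refl_pos[OF minus_in_R[OF refl.hyps(2)]] by simp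
  qed (use refl simple_word_root_refl_pos in blast)
  then show ?case using refl.IH simple_word_comp by blast
qed

section \<open>Stabilizers of regular points\<close>

text \<open>The orbit point with the largest inner product with \<open>alcove_point\<close> is
  dominant, since a simple reflection could otherwise increase it, and regularity makes it strictly
  dominant. An element fixing such a point sends no simple root to a negative one, so it is the
  identity by \<open>positive_word_id\<close>.\<close>

lemma weyl_trivial_stabilizer:
  assumes w: "w \<in> weyl R" and x: "w x = x" and reg: "\<And>\<alpha>. \<alpha> \<in> R \<Longrightarrow> blinfun_apply \<alpha> x \<noteq> 0"
  shows "w = id"
proof -
  let ?A = "(\<lambda>u. u x \<bullet> alcove_point) ` weyl R"
  have "Max ?A \<in> ?A" using finite_weyl weyl.weyl_id[of R] by (intro Max_in) auto
  then obtain u where u: "u \<in> weyl R" "u x \<bullet> alcove_point = Max ?A" by force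
  have max: "u' x \<bullet> alcove_point \<le> u x \<bullet> alcove_point" if "u' \<in> weyl R" for u'
    unfolding u(2) using finite_weyl that by (intro Max_ge) auto
  have dom: "blinfun_apply \<alpha> (u x) > 0" if "\<alpha> \<in> F" for \<alpha>
  proof -
    have \<alpha>: "\<alpha> \<in> R" using that F_subset by blast
    have "blinfun_apply \<alpha> (u x) \<noteq> 0"
      using reg[OF pull_in_R[OF u(1) \<alpha>]] by (simp add: apply_pull[OF u(1)])
    moreover have "blinfun_apply \<alpha> (u x) * (coroot \<alpha> \<bullet> alcove_point) \<ge> 0"
      using max[OF weyl.weyl_refl[OF u(1) \<alpha>]] by (simp add: root_refl_def inner_diff_left)
    moreover have "coroot \<alpha> \<bullet> alcove_point > 0"
      using simple_alcove_pos[OF that] dual_inner_pos[OF root_nonzero[OF \<alpha>]] by (simp add: inner_coroot)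
    ultimately show ?thesis by (metis less_eq_real_def mult_neg_pos not_less_iff_gr_or_eq not_le)
  qed
  \<comment> \<open>Conjugating by \<open>u\<close> replaces the stabilizer of \<open>x\<close> by
    that of the dominant point \<open>u x\<close>.\<close>
  define v where "v = u \<circ> w \<circ> inv u"
  have v: "v \<in> weyl R" unfolding v_def using u w weyl_comp weyl_inv by blast
  have vx: "v (u x) = u x" unfolding v_def using u x by simp
  have "blinfun_apply \<alpha> (v alcove_point) > 0" if "\<alpha> \<in> F" for \<alpha>
  proof -
    have \<gamma>: "pull v \<alpha> \<in> R" using pull_in_R[OF v] that F_subset by blast
    have "blinfun_apply (pull v \<alpha>) (u x) > 0" using dom[OF that] vx by (simp add: apply_pull[OF v])
    then have "- pull v \<alpha> \<notin> nat_comb F"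
      using nat_comb_nonneg[of "- pull v \<alpha>" F "u x"] dom by (force simp: uminus_blinfun.rep_eq)
    then show ?thesis using root_sign[OF \<gamma>] root_pos_iff[OF \<gamma>] by (auto simp: apply_pull[OF v])
  qed
  then have "v = id" using weyl_simple_word[OF v] positive_word_id by blast
  have "w y = y" for y
  proof -
    have "v (u y) = u y" using \<open>v = id\<close> by simp
    then have "u (w y) = u y" unfolding v_def using u by simp
    then show ?thesis using weyl_bij[OF u(1)] by (metis bij_pointE)
  qed
  then show ?thesis by auto
qed

text \<open>The vectors \<open>p\<close> and \<open>q\<close> of the real and imaginary parts are
  both fixed by \<open>w\<close>, but neither has to be regular. Each root vanishes at
  \<open>p + t *\<^sub>R q\<close> for at most one real \<open>t\<close>, so almost every
  \<open>t\<close> gives a regular real point fixed by \<open>w\<close>.\<close>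

lemma weyl_trivial_stabilizer_complex:
  fixes \<mu> :: "'v \<Rightarrow>\<^sub>L complex"
  assumes w: "w \<in> weyl R" and \<mu>: "pull w \<mu> = \<mu>"
    and reg: "\<And>\<alpha>. \<alpha> \<in> R \<Longrightarrow> blinfun_apply \<mu> (coroot \<alpha>) \<noteq> 0"
  shows "w = id"
proof -
  define p where "p = (\<Sum>b\<in>Basis. Re (blinfun_apply \<mu> b) *\<^sub>R (b :: 'v))"
  define q where "q = (\<Sum>b\<in>Basis. Im (blinfun_apply \<mu> b) *\<^sub>R (b :: 'v))"
  have p: "p \<bullet> v = Re (blinfun_apply \<mu> v)" for v
    unfolding p_def blinfun_apply_Basis_sum[of \<mu> v]
    by (simp add: inner_sum_left inner_commute[of v] mult.commute)
  have q: "q \<bullet> v = Im (blinfun_apply \<mu> v)" for v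
    unfolding q_def blinfun_apply_Basis_sum[of \<mu> v]
    by (simp add: inner_sum_left inner_commute[of v] mult.commute)
  have w\<mu>: "blinfun_apply \<mu> (w v) = blinfun_apply \<mu> v" for v
    using \<mu> apply_pull[OF w] by metis
  have fixp: "w z = z" if "\<And>v. z \<bullet> w v = z \<bullet> v" for z
  proof -
    have "w z \<bullet> w v = z \<bullet> w v" for v
      using that weyl_isometry[OF w] by metis
    then have "w z \<bullet> v = z \<bullet> v" for v
      using weyl_inv_apply(2)[OF w, of v] by metis
    then show ?thesis by (intro vector_eq_rdot[THEN iffD1]) blast
  qed
  have wp: "w p = p" by (rule fixp) (simp add: p w\<mu>)
  have wq: "w q = q" by (rule fixp) (simp add: q w\<mu>)
  have "finite {t. p \<bullet> coroot \<alpha> + t * (q \<bullet> coroot \<alpha>) = 0}" if "\<alpha> \<in> R" for \<alpha>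
  proof (cases "q \<bullet> coroot \<alpha> = 0")
    case True
    then show ?thesis using reg[OF that] by (simp add: p q complex_eq_iff)
  next
    case False
    then have "{t. p \<bullet> coroot \<alpha> + t * (q \<bullet> coroot \<alpha>) = 0} \<subseteq> {- (p \<bullet> coroot \<alpha>) / (q \<bullet> coroot \<alpha>)}"
      by (auto simp: field_simps)
    then show ?thesis by (rule finite_subset) simp
  qed
  then have "finite (\<Union>\<alpha>\<in>R. {t. p \<bullet> coroot \<alpha> + t * (q \<bullet> coroot \<alpha>) = 0})"
    using finite_R by blast
  then obtain t :: real where t: "t \<notin> (\<Union>\<alpha>\<in>R. {t. p \<bullet> coroot \<alpha> + t * (q \<bullet> coroot \<alpha>) = 0})"
    using ex_new_if_finite infinite_UNIV_char_0 by blast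
  show ?thesis
  proof (rule weyl_trivial_stabilizer[OF w])
    show "w (p + t *\<^sub>R q) = p + t *\<^sub>R q"
      using wp wq weyl_linear[OF w] by (simp add: linear_add linear_scale)
    fix \<alpha> assume "\<alpha> \<in> R"
    then have "coroot \<alpha> \<bullet> (p + t *\<^sub>R q) \<noteq> 0"
      using t by (auto simp: inner_add_right inner_commute)
    then show "blinfun_apply \<alpha> (p + t *\<^sub>R q) \<noteq> 0" by (simp add: inner_coroot)
  qed
qed

end

section \<open>Generators of the extended affine Weyl group\<close>

lemma aff_fun_inject: "aff_fun \<alpha> m = aff_fun \<beta> n \<longleftrightarrow> \<alpha> = \<beta> \<and> m = n"
proof
  assume eq: "aff_fun \<alpha> m = aff_fun \<beta> n"
  have "m = n" using fun_cong[OF eq, of 0] by (simp add: aff_fun_def blinfun.zero_right)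
  moreover have "blinfun_apply \<alpha> v = blinfun_apply \<beta> v" for v
    using fun_cong[OF eq, of v] \<open>m = n\<close> by (simp add: aff_fun_def)
  ultimately show "\<alpha> = \<beta> \<and> m = n" using blinfun_eqI by blast
qed simp

lemma grad_aff_fun [simp]: "grad (aff_fun \<alpha> m) = \<alpha>"
  unfolding grad_def by (rule the_equality) (auto simp: aff_fun_inject)

lemma aff_refl_apply:
  "aff_refl (aff_fun \<alpha> m) v = v - (blinfun_apply \<alpha> v + of_int m) *\<^sub>R coroot \<alpha>"
  unfolding aff_refl_def grad_aff_fun by (simp add: aff_fun_def)

text \<open>The linear reflection negates \<open>coroot \<alpha>\<close>: subtracting a multiple of
  it afterwards is the same as adding it beforehand.\<close>

lemma aff_refl_aff_fun:
  assumes "\<alpha> \<noteq> 0"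
  shows "aff_refl (aff_fun \<alpha> m) = root_refl \<alpha> \<circ> transl (of_int m *\<^sub>R coroot \<alpha>)"
  by (rule ext) (simp add: aff_refl_apply root_refl_def transl_def blinfun.add_right
      blinfun.scaleR_right apply_coroot_self[OF assms] algebra_simps flip: scaleR_2)

section \<open>Group structure of the extended affine Weyl group\<close>

locale affine_roots = based_roots R F \<theta>
  for R F :: "('v::euclidean_space \<Rightarrow>\<^sub>L real) set" and \<theta> +
  fixes X :: "('v \<Rightarrow>\<^sub>L real) set"
  assumes admissible: "admissible_lattice R X"
begin

lemma int_span_base: "x \<in> S \<Longrightarrow> x \<in> int_span (S :: 'b::real_vector set)"
proof -
  interpret module "\<lambda>(n::int) x. of_int n *\<^sub>R (x :: 'b)"
    by unfold_locales (auto simp: scaleR_right_distrib scaleR_left_distrib)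
  show "x \<in> S \<Longrightarrow> x \<in> int_span S" by (rule span_base)
qed

lemma coroot_in_Y: "\<alpha> \<in> R \<Longrightarrow> coroot \<alpha> \<in> dual_lattice X"
  using admissible int_span_base[of "coroot \<alpha>" "coroot ` R"] by (auto simp: admissible_lattice_def)

lemma root_Y_Ints: "\<alpha> \<in> R \<Longrightarrow> y \<in> dual_lattice X \<Longrightarrow> blinfun_apply \<alpha> y \<in> \<int>"
  using admissible int_span_base[of \<alpha> R] by (auto simp: admissible_lattice_def dual_lattice_def)

lemma Y_0: "0 \<in> dual_lattice X"
  and Y_add: "y \<in> dual_lattice X \<Longrightarrow> z \<in> dual_lattice X \<Longrightarrow> y + z \<in> dual_lattice X"
  and Y_uminus: "y \<in> dual_lattice X \<Longrightarrow> - y \<in> dual_lattice X"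
  and Y_scale: "y \<in> dual_lattice X \<Longrightarrow> r \<in> \<int> \<Longrightarrow> r *\<^sub>R y \<in> dual_lattice X"
  by (auto simp: dual_lattice_def blinfun.zero_right blinfun.add_right blinfun.minus_right
      blinfun.scaleR_right)

text \<open>Both inclusions of an admissible lattice enter: roots in \<open>X\<close> take integral
  values on \<open>dual_lattice X\<close>, and coroots lie in \<open>dual_lattice X\<close>.\<close>

lemma weyl_Y: "w \<in> weyl R \<Longrightarrow> y \<in> dual_lattice X \<Longrightarrow> w y \<in> dual_lattice X"
proof (induction w rule: weyl_induct)
  case (refl w \<alpha>)
  have "w y + (- blinfun_apply \<alpha> (w y)) *\<^sub>R coroot \<alpha> \<in> dual_lattice X"
    using refl by (intro Y_add Y_scale coroot_in_Y Ints_minus root_Y_Ints) auto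
  then show ?case by (simp add: root_refl_def)
qed simp

abbreviation "Wa \<equiv> aff_weyl R X"

lemma aff_weylI: "w \<in> weyl R \<Longrightarrow> y \<in> dual_lattice X \<Longrightarrow> w \<circ> transl y \<in> Wa"
  by (auto simp: aff_weyl_def)

lemma aff_weylE:
  assumes "g \<in> Wa"
  obtains w y where "w \<in> weyl R" "y \<in> dual_lattice X" "g = w \<circ> transl y"
  using assms by (auto simp: aff_weyl_def)

lemma transl_0 [simp]: "transl 0 = id"
  by (auto simp: transl_def)

lemma weyl_in_Wa: "w \<in> weyl R \<Longrightarrow> w \<in> Wa"
  using aff_weylI[OF _ Y_0] by simp

lemma transl_in_Wa: "y \<in> dual_lattice X \<Longrightarrow> transl y \<in> Wa"
  using aff_weylI[OF weyl.weyl_id] by simp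

lemma id_in_Wa: "id \<in> Wa"
  using weyl_in_Wa[OF weyl.weyl_id] .

lemma transl_weyl:
  assumes "w \<in> weyl R"
  shows "transl y \<circ> w = w \<circ> transl (inv w y)"
  by (rule ext) (simp add: transl_def linear_add weyl_linear assms)

lemma transl_add: "transl y \<circ> transl z = transl (z + y)"
  by (rule ext) (simp add: transl_def add.assoc)

lemma comp_normal_form:
  assumes "w' \<in> weyl R"
  shows "(w \<circ> transl y) \<circ> (w' \<circ> transl y') = (w \<circ> w') \<circ> transl (y' + inv w' y)"
proof -
  have "(w \<circ> transl y) \<circ> (w' \<circ> transl y') = w \<circ> (transl y \<circ> w') \<circ> transl y'"
    by (simp only: comp_assoc)
  then show ?thesis
    by (simp only: transl_weyl[OF assms] comp_assoc transl_add)
qed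

lemma Wa_comp: "g \<in> Wa \<Longrightarrow> h \<in> Wa \<Longrightarrow> g \<circ> h \<in> Wa"
  by (elim aff_weylE) (simp only: comp_normal_form aff_weylI weyl_comp Y_add weyl_Y weyl_inv)

lemma Wa_inverse:
  assumes "w \<in> weyl R"
  shows "(inv w \<circ> transl (- w y)) \<circ> (w \<circ> transl y) = id"
    "(w \<circ> transl y) \<circ> (inv w \<circ> transl (- w y)) = id"
  using assms weyl_inv[OF assms]
  by (auto simp: fun_eq_iff transl_def linear_add linear_diff weyl_linear)

lemma inv_Wa: "w \<in> weyl R \<Longrightarrow> inv (w \<circ> transl y) = inv w \<circ> transl (- w y)"
  using inv_unique_comp Wa_inverse by blast

lemma Wa_inv: "g \<in> Wa \<Longrightarrow> inv g \<in> Wa"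
  by (elim aff_weylE) (simp only: inv_Wa aff_weylI weyl_inv Y_uminus weyl_Y)

lemma Wa_bij: "g \<in> Wa \<Longrightarrow> bij g"
  by (elim aff_weylE) (metis Wa_inverse o_bij)

lemma Wa_inv_apply: "g \<in> Wa \<Longrightarrow> inv g (g v) = v" "g \<in> Wa \<Longrightarrow> g (inv g v) = v"
  using Wa_bij by (auto simp: bij_is_inj bij_is_surj surj_f_inv_f)

lemma inv_inv_Wa: "g \<in> Wa \<Longrightarrow> inv (inv g) = g"
  using Wa_bij inv_inv_eq by blast

lemma lin_part_eq:
  assumes "w \<in> weyl R" "y \<in> dual_lattice X"
  shows "lin_part R X (w \<circ> transl y) = w"
  unfolding lin_part_def
proof (rule the_equality)
  fix u assume u: "u \<in> weyl R \<and> (\<exists>z\<in>dual_lattice X. w \<circ> transl y = u \<circ> transl z)"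
  then obtain z where z: "w \<circ> transl y = u \<circ> transl z" by blast
  have *: "w (v + y) = u (v + z)" for v
    using fun_cong[OF z, of v] by (simp add: transl_def)
  show "u = w"
  proof
    fix v
    show "u v = w v"
      using *[of v] *[of 0] u assms by (simp add: linear_add weyl_linear)
  qed
qed (use assms in blast)

lemma lin_part_weyl [simp]: "w \<in> weyl R \<Longrightarrow> lin_part R X w = w"
  using lin_part_eq[OF _ Y_0] by simp

lemma lin_part_transl [simp]: "y \<in> dual_lattice X \<Longrightarrow> lin_part R X (transl y) = id"
  using lin_part_eq[OF weyl.weyl_id] by simp

lemma lin_part_in_weyl: "g \<in> Wa \<Longrightarrow> lin_part R X g \<in> weyl R"
  by (elim aff_weylE) (simp add: lin_part_eq)

lemma lin_part_comp:
  assumes "g \<in> Wa" "h \<in> Wa"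
  shows "lin_part R X (g \<circ> h) = lin_part R X g \<circ> lin_part R X h"
proof -
  obtain w y where g: "w \<in> weyl R" "y \<in> dual_lattice X" "g = w \<circ> transl y"
    using assms(1) by (rule aff_weylE)
  obtain u z where h: "u \<in> weyl R" "z \<in> dual_lattice X" "h = u \<circ> transl z"
    using assms(2) by (rule aff_weylE)
  have "z + inv u y \<in> dual_lattice X" using g h Y_add weyl_Y weyl_inv by blast
  then show ?thesis
    unfolding g(3) h(3) comp_normal_form[OF h(1)] using g h weyl_comp by (simp only: lin_part_eq)
qed

text \<open>This splitting is what makes the translate of an exponential a scalar times the
  exponential of the rotated functional.\<close>

lemma inv_Wa_apply:
  assumes "g \<in> Wa"
  shows "inv g v = inv (lin_part R X g) v + inv g 0"
proof -
  obtain w y where g: "w \<in> weyl R" "y \<in> dual_lattice X" "g = w \<circ> transl y"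
    using assms by (rule aff_weylE)
  have "linear (inv w)" using weyl_linear weyl_inv g(1) by blast
  then show ?thesis
    unfolding g(3) inv_Wa[OF g(1)] lin_part_eq[OF g(1,2)]
    using g(1) by (simp add: transl_def linear_diff linear_neg)
qed

lemma aff_refl_in_Wa:
  assumes "\<alpha> \<in> R"
  shows "aff_refl (aff_fun \<alpha> m) \<in> Wa"
    and "lin_part R X (aff_refl (aff_fun \<alpha> m)) = root_refl \<alpha>"
proof -
  have "of_int m *\<^sub>R coroot \<alpha> \<in> dual_lattice X" using Y_scale coroot_in_Y assms by simp
  then show "aff_refl (aff_fun \<alpha> m) \<in> Wa" "lin_part R X (aff_refl (aff_fun \<alpha> m)) = root_refl \<alpha>"
    unfolding aff_refl_aff_fun[OF root_nonzero[OF assms]]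
    using aff_weylI lin_part_eq root_refl_in_weyl[OF assms] by blast+
qed

lemma aff_refl_invol:
  assumes "\<alpha> \<in> R"
  shows "aff_refl (aff_fun \<alpha> m) (aff_refl (aff_fun \<alpha> m) v) = v"
  using root_nonzero[OF assms]
  by (simp add: aff_refl_apply blinfun.diff_right blinfun.add_right blinfun.scaleR_right
      apply_coroot_self algebra_simps flip: scaleR_2)

lemma inv_aff_refl: "\<alpha> \<in> R \<Longrightarrow> inv (aff_refl (aff_fun \<alpha> m)) = aff_refl (aff_fun \<alpha> m)"
  by (rule inv_equality) (simp_all add: aff_refl_invol)

lemma aff_fun_aff_refl:
  assumes "\<alpha> \<in> R"
  shows "aff_fun \<alpha> m (aff_refl (aff_fun \<alpha> m) v) = - aff_fun \<alpha> m v"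
  using root_nonzero[OF assms]
  unfolding aff_refl_apply
  by (simp add: aff_fun_def blinfun.diff_right blinfun.scaleR_right apply_coroot_self)

lemma aff_root_comp:
  assumes "a \<in> aff_roots R" "g \<in> Wa"
  shows "(\<lambda>v. a (g v)) \<in> aff_roots R"
proof -
  obtain w y where g: "w \<in> weyl R" "y \<in> dual_lattice X" "g = w \<circ> transl y"
    using assms(2) by (rule aff_weylE)
  obtain \<alpha> m where a: "a = aff_fun \<alpha> m" "\<alpha> \<in> R" using assms(1) by (auto simp: aff_roots_def)
  obtain n where n: "blinfun_apply (pull w \<alpha>) y = of_int n"
    using root_Y_Ints[OF pull_in_R[OF g(1) a(2)] g(2)] by (auto elim: Ints_cases)
  have "(\<lambda>v. a (g v)) = aff_fun (pull w \<alpha>) (n + m)"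
    using n by (auto simp: a(1) g(3) aff_fun_def transl_def fun_eq_iff apply_pull[OF g(1)]
        linear_add[OF weyl_linear[OF g(1)]] blinfun.add_right)
  then show ?thesis using pull_in_R[OF g(1) a(2)] by (auto simp: aff_roots_def)
qed

section \<open>Positive affine roots and separating hyperplanes\<close>

lemma root_alcove_abs: "\<alpha> \<in> R \<Longrightarrow> \<bar>blinfun_apply \<alpha> alcove_point\<bar> < 1"
  using root_alcove_le_theta[of \<alpha>] root_alcove_le_theta[OF minus_in_R, of \<alpha>] theta_alcove_less_1
  by (simp add: uminus_blinfun.rep_eq)

text \<open>Roots take values strictly between -1 and 1 at the base point, so a nonzero integer
  constant decides the sign.\<close>

lemma aff_fun_alcove_pos_iff:
  "\<alpha> \<in> R \<Longrightarrow> aff_fun \<alpha> m alcove_point > 0 \<longleftrightarrow> m > 0 \<or> m = 0 \<and> blinfun_apply \<alpha> alcove_point > 0"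
  using root_alcove_abs[of \<alpha>] unfolding aff_fun_def by linarith

lemma aff_pos_eq: "aff_pos R F = {a \<in> aff_roots R. a alcove_point > 0}"
proof -
  have "aff_fun \<alpha> m alcove_point > 0 \<longleftrightarrow> m > 0 \<or> m = 0 \<and> \<alpha> \<in> nat_comb F" if "\<alpha> \<in> R" for \<alpha> m
    using aff_fun_alcove_pos_iff root_pos_iff that by blast
  then show ?thesis
    unfolding aff_pos_def aff_roots_def pos_roots_def by blast
qed

lemma minus_aff_fun: "(\<lambda>v. - aff_fun \<alpha> m v) = aff_fun (- \<alpha>) (- m)"
  by (auto simp: aff_fun_def uminus_blinfun.rep_eq)

lemma minus_aff_root: "a \<in> aff_roots R \<Longrightarrow> (\<lambda>v. - a v) \<in> aff_roots R"
  unfolding aff_roots_def using minus_aff_fun minus_in_R by blast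

lemma aff_neg_eq: "aff_neg R F = {a \<in> aff_roots R. a alcove_point < 0}"
proof (intro set_eqI iffI)
  fix a assume "a \<in> {a \<in> aff_roots R. a alcove_point < 0}"
  then have "(\<lambda>v. - a v) \<in> aff_pos R F" using minus_aff_root by (auto simp: aff_pos_eq)
  then have "(\<lambda>v. - (- a v)) \<in> aff_neg R F" unfolding aff_neg_def by (rule imageI)
  then show "a \<in> aff_neg R F" by simp
qed (auto simp: aff_neg_def aff_pos_eq minus_aff_root)

text \<open>The affine root hyperplanes between the base point and \<open>d\<close>, each
  represented by its root positive at the base point. It is attached to a point instead of a group
  element so that \<open>d\<close> itself can be reflected.\<close>

definition separating :: "'v \<Rightarrow> ('v \<Rightarrow> real) set" where
  "separating d = {a \<in> aff_roots R. a alcove_point > 0 \<and> a d < 0}"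

text \<open>An affine root \<open>a\<close> is the pullback under \<open>g\<close> of the root
  sending \<open>v\<close> to \<open>a (inv g v)\<close>, and the latter is negative exactly when
  \<open>a\<close> is negative at \<open>inv g alcove_point\<close>.\<close>

lemma aff_length_eq:
  assumes "g \<in> Wa"
  shows "aff_length R F g = card (separating (inv g alcove_point))"
proof -
  have "aff_pos R F \<inter> fun_act (inv g) ` aff_neg R F = separating (inv g alcove_point)"
  proof (intro set_eqI iffI)
    fix a assume "a \<in> aff_pos R F \<inter> fun_act (inv g) ` aff_neg R F"
    then show "a \<in> separating (inv g alcove_point)"
      by (auto simp: separating_def aff_pos_eq aff_neg_eq fun_act_def inv_inv_Wa[OF assms]
          Wa_inv_apply[OF assms])
  next
    fix a assume a: "a \<in> separating (inv g alcove_point)"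
    then have "(\<lambda>v. a (inv g v)) \<in> aff_neg R F"
      using aff_root_comp Wa_inv[OF assms] by (auto simp: separating_def aff_neg_eq)
    moreover have "a = fun_act (inv g) (\<lambda>v. a (inv g v))"
      by (simp add: fun_act_def inv_inv_Wa[OF assms] Wa_inv_apply[OF assms])
    ultimately show "a \<in> aff_pos R F \<inter> fun_act (inv g) ` aff_neg R F"
      using a by (auto simp: separating_def aff_pos_eq)
  qed
  then show ?thesis by (simp add: aff_length_def)
qed

lemma finite_separating: "finite (separating d)"
proof (rule finite_subset)
  show "separating d \<subseteq> (\<Union>\<alpha>\<in>R. aff_fun \<alpha> ` {0..\<lceil>- blinfun_apply \<alpha> d\<rceil>})"
  proof
    fix a assume a: "a \<in> separating d"
    then obtain \<alpha> m where am: "a = aff_fun \<alpha> m" "\<alpha> \<in> R"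
      by (auto simp: separating_def aff_roots_def)
    have "m \<ge> 0" using a aff_fun_alcove_pos_iff[OF am(2), of m] by (auto simp: am separating_def)
    moreover have "of_int m < - blinfun_apply \<alpha> d"
      using a by (simp add: am separating_def aff_fun_def)
    then have "m \<le> \<lceil>- blinfun_apply \<alpha> d\<rceil>" by linarith
    ultimately show "a \<in> (\<Union>\<alpha>\<in>R. aff_fun \<alpha> ` {0..\<lceil>- blinfun_apply \<alpha> d\<rceil>})"
      unfolding am(1) using am(2) by (intro UN_I[OF am(2)] imageI) simp
  qed
qed (use finite_R in auto)

lemma aff_basisE:
  assumes "a \<in> aff_basis F \<theta>"
  obtains \<alpha> m where "a = aff_fun \<alpha> m" "\<alpha> \<in> R"
  using assms F_subset theta_in_R minus_in_R by (auto simp: aff_basis_def)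

lemma aff_refl_basis_in_Wa: "a \<in> aff_basis F \<theta> \<Longrightarrow> aff_refl a \<in> Wa"
  by (elim aff_basisE) (simp add: aff_refl_in_Wa)

lemma aff_basis_in_roots: "a \<in> aff_basis F \<theta> \<Longrightarrow> a \<in> aff_roots R"
  by (elim aff_basisE) (auto simp: aff_roots_def)

lemma aff_basis_alcove_pos: "a \<in> aff_basis F \<theta> \<Longrightarrow> a alcove_point > 0"
  using simple_alcove_pos theta_alcove_less_1
  by (auto simp: aff_basis_def aff_fun_def uminus_blinfun.rep_eq)

text \<open>Otherwise \<open>d\<close> lies in the closed fundamental alcove. There positive roots
  are nonnegative, and by maximality of \<theta> every root is at least -1, so a positive integer
  constant makes any affine root nonnegative: nothing separates.\<close>

lemma ex_separating_simple:
  assumes "separating d \<noteq> {}"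
  shows "\<exists>a\<in>aff_basis F \<theta>. a d < 0"
proof (rule ccontr)
  assume "\<not> ?thesis"
  then have nn: "a d \<ge> 0" if "a \<in> aff_basis F \<theta>" for a using that by force
  have F: "blinfun_apply \<beta> d \<ge> 0" if "\<beta> \<in> F" for \<beta>
    using nn[of "aff_fun \<beta> 0"] that by (simp add: aff_basis_def aff_fun_def)
  have \<theta>: "blinfun_apply \<theta> d \<le> 1"
    using nn[of "aff_fun (- \<theta>) 1"] by (simp add: aff_basis_def aff_fun_def uminus_blinfun.rep_eq)
  obtain \<alpha> m where a: "\<alpha> \<in> R" "aff_fun \<alpha> m alcove_point > 0" "aff_fun \<alpha> m d < 0"
    using assms by (auto simp: separating_def aff_roots_def)
  have "blinfun_apply (- \<alpha>) d \<le> blinfun_apply \<theta> d"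
    using nat_comb_nonneg[OF theta_highest[OF minus_in_R[OF a(1)]], of d] F
    by (simp add: blinfun.add_left uminus_blinfun.rep_eq)
  then have 1: "blinfun_apply \<alpha> d \<ge> - 1" using \<theta> by (simp add: uminus_blinfun.rep_eq)
  consider "m > 0" | "m = 0" "blinfun_apply \<alpha> alcove_point > 0"
    using aff_fun_alcove_pos_iff[OF a(1)] a(2) by blast
  then show False
  proof cases
    case 1
    then have "of_int m \<ge> (1 :: real)" by simp
    then show ?thesis using a(3) \<open>blinfun_apply \<alpha> d \<ge> - 1\<close> by (simp add: aff_fun_def)
  next
    case 2
    then have "\<alpha> \<in> nat_comb F" using root_pos_iff[OF a(1)] by blast
    then show ?thesis using nat_comb_nonneg[of \<alpha> F d] F a(3) 2 by (simp add: aff_fun_def)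
  qed
qed

text \<open>The affine form of \<open>simple_refl_pos\<close>. For a simple root of \<open>R\<close>
  the integer constant is unchanged by the reflection. For the remaining affine root the base-point
  value changes by an integer multiple of 1 minus the value of \<theta>, and the highest root
  property limits how negative this multiple is.\<close>

lemma aff_simple_refl_pos:
  assumes a: "a \<in> aff_basis F \<theta>" and b: "b \<in> aff_roots R" "b alcove_point > 0" "b \<noteq> a"
  shows "b (aff_refl a alcove_point) > 0"
proof -
  obtain \<beta> m where bm: "b = aff_fun \<beta> m" "\<beta> \<in> R" using b(1) by (auto simp: aff_roots_def)
  have m: "m > 0 \<or> m = 0 \<and> blinfun_apply \<beta> alcove_point > 0"
    using aff_fun_alcove_pos_iff[OF bm(2)] b(2) bm(1) by blast
  consider \<alpha> where "\<alpha> \<in> F" "a = aff_fun \<alpha> 0" | "a = aff_fun (- \<theta>) 1"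
    using a by (auto simp: aff_basis_def)
  then show ?thesis
  proof cases
    case (1 \<alpha>)
    have \<alpha>: "\<alpha> \<in> R" using 1 F_subset by blast
    have s: "aff_refl a alcove_point = root_refl \<alpha> alcove_point"
      by (simp add: 1 aff_refl_apply root_refl_def)
    show ?thesis
    proof (cases "m > 0")
      case True
      have "aff_fun (pull (root_refl \<alpha>) \<beta>) m alcove_point > 0"
        using aff_fun_alcove_pos_iff[OF pull_in_R[OF root_refl_in_weyl[OF \<alpha>] bm(2)]] True by blast
      then show ?thesis by (simp add: s bm(1) aff_fun_def pull_apply[OF linear_root_refl])
    next
      case False
      then have "\<beta> \<noteq> \<alpha>" "m = 0" using m b(3) bm(1) 1 by auto
      then show ?thesis using simple_refl_pos[OF 1(1) bm(2)] m by (simp add: s bm(1) aff_fun_def)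
    qed
  next
    case 2
    obtain n where n: "blinfun_apply \<beta> (coroot \<theta>) = of_int n"
      using crystallographic bm(2) theta_in_R unfolding crystallographic_def by (meson Ints_cases)
    let ?t = "blinfun_apply \<theta> alcove_point"
    have val: "b (aff_refl a alcove_point) =
        blinfun_apply \<beta> alcove_point + of_int m + of_int n * (1 - ?t)"
      unfolding 2 bm(1) aff_refl_apply
      by (simp add: aff_fun_def coroot_minus uminus_blinfun.rep_eq
          blinfun.add_right blinfun.diff_right blinfun.scaleR_right n algebra_simps)
    have bc: "blinfun_apply \<beta> alcove_point + of_int m > 0" using b(2) by (simp add: bm(1) aff_fun_def)
    show ?thesis
    proof (cases "n \<ge> 0")
      case True
      then have "of_int n * (1 - ?t) \<ge> 0" using theta_alcove_less_1 by simp
      then show ?thesis using bc val by linarith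
    next
      case False
      show ?thesis
      proof (cases "\<beta> = - \<theta>")
        case True
        have "of_int n = (-2 :: real)"
          using n apply_coroot_self[OF root_nonzero[OF theta_in_R]]
          by (simp add: True uminus_blinfun.rep_eq)
        \<comment> \<open>The constant 1 would give \<open>a\<close> itself, and the constant 0
          would give a root that is negative at the base point.\<close>
        moreover have "m \<ge> 2"
        proof -
          have "m \<noteq> 1" using b(3) 2 True bm(1) by auto
          moreover have "m \<noteq> 0" using m True theta_alcove_pos by (auto simp: uminus_blinfun.rep_eq)
          ultimately show ?thesis using m by linarith
        qed
        then have "of_int m \<ge> (2 :: real)" by simp
        ultimately show ?thesis
          unfolding val using theta_alcove_pos by (simp add: True uminus_blinfun.rep_eq)
      next
        case neq: False
        have R': "\<beta> - of_int n *\<^sub>R \<theta> \<in> R" using refl_in_R[OF theta_in_R bm(2)] n by simp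
        have le: "blinfun_apply \<beta> alcove_point - of_int n * ?t \<le> ?t"
          using root_alcove_le_theta[OF R'] by (simp add: minus_blinfun.rep_eq scaleR_blinfun.rep_eq)
        have lt: "- blinfun_apply \<beta> alcove_point < ?t"
          using root_alcove_less_theta[OF minus_in_R[OF bm(2)]] neq
          by (metis minus_minus uminus_blinfun.rep_eq)
        \<comment> \<open>The reflected root \<open>\<beta> - of_int n *\<^sub>R \<theta>\<close>
          cannot exceed \<theta> at the base point, while \<beta> lies strictly above the value of -
          \<theta> there; this rules out \<open>n\<close> below -1.\<close>
        have "n = -1"
        proof (rule ccontr)
          assume "n \<noteq> -1"
          then have "of_int n \<le> (-2 :: real)" using False by simp
          then have "of_int n * ?t \<le> - 2 * ?t" using theta_alcove_pos by (intro mult_right_mono) auto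
          then show False using le lt by linarith
        qed
        then have le': "blinfun_apply \<beta> alcove_point \<le> 0" using le by simp
        then have "m > 0" using m by auto
        then have "of_int m \<ge> (1 :: real)" by simp
        then show ?thesis unfolding val \<open>n = -1\<close> using lt by simp
      qed
    qed
  qed
qed

text \<open>Composition with the reflection injects the separating roots of the reflected point into
  those of \<open>d\<close>: every positive affine root other than \<open>a\<close> stays positive,
  and \<open>a\<close> does not occur because it changes sign. The root \<open>a\<close> separates
  \<open>d\<close> but is not in the image.\<close>

lemma card_separating_aff_refl:
  assumes a: "a \<in> aff_basis F \<theta>" and d: "a d < 0"
  shows "card (separating (aff_refl a d)) < card (separating d)"
proof -
  obtain \<alpha> m where am: "a = aff_fun \<alpha> m" "\<alpha> \<in> R" using a by (rule aff_basisE)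
  have invol: "aff_refl a (aff_refl a v) = v" for v unfolding am(1) by (rule aff_refl_invol[OF am(2)])
  have neg: "a (aff_refl a v) = - a v" for v unfolding am(1) by (rule aff_fun_aff_refl[OF am(2)])
  let ?f = "\<lambda>b v. b (aff_refl a v)"
  have "inj_on ?f (separating (aff_refl a d))"
  proof (rule inj_onI, rule ext)
    fix b b' v assume "?f b = ?f b'"
    from fun_cong[OF this, of "aff_refl a v"] show "b v = b' v" by (simp add: invol)
  qed
  moreover have "?f ` separating (aff_refl a d) \<subseteq> separating d - {a}"
  proof
    fix b' assume "b' \<in> ?f ` separating (aff_refl a d)"
    then obtain b where b: "b \<in> aff_roots R" "b alcove_point > 0" "b (aff_refl a d) < 0" "b' = ?f b"
      by (auto simp: separating_def)
    have "b \<noteq> a" using b(3) neg[of d] d by auto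
    then have "b (aff_refl a alcove_point) > 0" using aff_simple_refl_pos[OF a b(1,2)] by blast
    moreover have "?f b \<in> aff_roots R" using aff_root_comp[OF b(1)] aff_refl_in_Wa(1) am by blast
    moreover have "?f b \<noteq> a"
    proof
      assume eq: "?f b = a"
      have "b alcove_point = - a alcove_point"
        using fun_cong[OF eq, of "aff_refl a alcove_point"] neg[of alcove_point] by (simp add: invol)
      then show False using b(2) aff_basis_alcove_pos[OF a] by simp
    qed
    ultimately show "b' \<in> separating d - {a}" using b by (auto simp: separating_def)
  qed
  ultimately have "card (separating (aff_refl a d)) \<le> card (separating d - {a})"
    using card_inj_on_le finite_separating by blast
  moreover have "a \<in> separating d"
    using d a aff_basis_in_roots aff_basis_alcove_pos by (auto simp: separating_def)
  ultimately show ?thesis using card_Diff1_less[OF finite_separating] by fastforce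
qed

lemma omegaI:
  assumes "g \<in> Wa" "separating (inv g alcove_point) = {}"
  shows "g \<in> omega_grp R X F"
  using assms by (simp add: omega_grp_def aff_length_eq)

lemma id_in_omega: "id \<in> omega_grp R X F"
  by (rule omegaI[OF id_in_Wa]) (auto simp: separating_def)

text \<open>Induction on the length, realised as the number of hyperplanes separating the base point
  from \<open>inv g alcove_point\<close>. Reflections are appended on the right because this
  reflects exactly that point; when no hyperplane is left, the element belongs to
  \<open>omega_grp\<close>.\<close>

lemma aff_weyl_generated [consumes 1, case_names omega aff_refl]:
  assumes "g \<in> Wa"
    and \<Omega>: "\<And>\<omega>. \<omega> \<in> omega_grp R X F \<Longrightarrow> P \<omega>"
    and s: "\<And>g a. g \<in> Wa \<Longrightarrow> P g \<Longrightarrow> a \<in> aff_basis F \<theta> \<Longrightarrow> P (g \<circ> aff_refl a)"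
  shows "P g"
  using assms(1)
proof (induction "card (separating (inv g alcove_point))" arbitrary: g rule: less_induct)
  case less
  show ?case
  proof (cases "separating (inv g alcove_point) = {}")
    case True
    then show ?thesis using \<Omega> omegaI less.prems by blast
  next
    case False
    then obtain a where a: "a \<in> aff_basis F \<theta>" "a (inv g alcove_point) < 0"
      using ex_separating_simple by blast
    obtain \<alpha> m where am: "a = aff_fun \<alpha> m" "\<alpha> \<in> R" using a(1) by (rule aff_basisE)
    have sW: "aff_refl a \<in> Wa" using aff_refl_in_Wa(1) am by blast
    have gW: "g \<circ> aff_refl a \<in> Wa" using Wa_comp less.prems sW by blast
    have "inv (g \<circ> aff_refl a) = aff_refl a \<circ> inv g"
      using o_inv_distrib[OF Wa_bij[OF less.prems] Wa_bij[OF sW]] inv_aff_refl am by simp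
    then have "card (separating (inv (g \<circ> aff_refl a) alcove_point)) <
        card (separating (inv g alcove_point))"
      using card_separating_aff_refl[OF a] by simp
    then have "P (g \<circ> aff_refl a)" using less.hyps gW by blast
    \<comment> \<open>The reflection is an involution, so \<open>g\<close> is obtained from the
      shorter element by appending it once more.\<close>
    then have "P ((g \<circ> aff_refl a) \<circ> aff_refl a)" using s gW a(1) by blast
    moreover have "(g \<circ> aff_refl a) \<circ> aff_refl a = g"
      unfolding am(1) by (rule ext) (simp add: aff_refl_invol am(2))
    ultimately show ?thesis by simp
  qed
qed

end

section \<open>Bethe wave functions\<close>

text \<open>Along the segment of integration the exponential has its own multiple by -1 /
  \<mu>(\<open>aff_coroot a\<close>) as antiderivative, and the upper endpoint of the segment is
  \<open>aff_refl a v\<close>.\<close>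

lemma int_op_cexp:
  assumes "blinfun_apply \<mu> (aff_coroot a) \<noteq> 0"
  shows "int_op a (cexp \<mu>) v =
    (cexp \<mu> v - cexp \<mu> (aff_refl a v)) / blinfun_apply \<mu> (aff_coroot a)"
proof -
  let ?z = "blinfun_apply \<mu> (aff_coroot a)"
  let ?f = "\<lambda>t. cexp \<mu> (v - t *\<^sub>R aff_coroot a)"
  let ?H = "\<lambda>t. - exp (blinfun_apply \<mu> v - complex_of_real t * ?z) / ?z"
  have f: "?f t = exp (blinfun_apply \<mu> v - complex_of_real t * ?z)" for t
    by (simp add: cexp_def blinfun.diff_right blinfun.scaleR_right scaleR_conv_of_real)
  have "(LBINT t=ereal 0..ereal (a v). ?f t) = ?H (a v) - ?H 0"
  proof (rule interval_integral_FTC_finite)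
    \<comment> \<open>The interval is written with \<open>min\<close> and \<open>max\<close> because
      \<open>a v\<close> may be negative.\<close>
    show "continuous_on {min 0 (a v)..max 0 (a v)} ?f"
      unfolding f by (intro continuous_intros)
    show "(?H has_vector_derivative ?f t) (at t within {min 0 (a v)..max 0 (a v)})" for t
      unfolding f using assms
      by (intro has_vector_derivative_real_field[where
            f = "\<lambda>t. - exp (blinfun_apply \<mu> v - t * ?z) / ?z"])
        (auto intro!: derivative_eq_intros)
  qed
  then show ?thesis
    unfolding int_op_def using f[of "a v"]
    by (simp add: aff_refl_def diff_divide_distrib) (simp add: cexp_def)
qed

lemma tensor_space_sum:
  assumes "finite A" "\<And>i. i \<in> A \<Longrightarrow> f i \<in> S"
  shows "(\<lambda>v. \<Sum>i\<in>A. pure_tensor sm (f i) (m i) v) \<in> tensor_space sm S"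
proof -
  obtain h where h: "bij_betw h {..<card A} A"
    using ex_bij_betw_nat_finite[OF assms(1)] by (auto simp: atLeast0LessThan)
  have "(\<lambda>v. \<Sum>i\<in>A. pure_tensor sm (f i) (m i) v) =
      (\<lambda>v. \<Sum>j<card A. pure_tensor sm (f (h j)) (m (h j)) v)"
    by (intro ext) (simp add: sum.reindex_bij_betw[OF h, symmetric])
  moreover have "\<forall>j<card A. f (h j) \<in> S"
    using assms(2) bij_betwE[OF h] by auto
  ultimately show ?thesis
    unfolding tensor_space_def by (auto intro!: exI[of _ "card A"] exI[of _ "\<lambda>j. f (h j)"]
        exI[of _ "\<lambda>j. m (h j)"])
qed

lemma pure_tensor_in_tensor_space: "f \<in> S \<Longrightarrow> pure_tensor sm f m \<in> tensor_space sm S"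
  using tensor_space_sum[of "{()}" "\<lambda>_. f" S sm "\<lambda>_. m"] by simp

lemma ga_act_superset:
  assumes "vector_space sm" "finite S" "Poly_Mapping.keys x \<subseteq> S"
  shows "ga_act sm \<rho> x m = (\<Sum>g\<in>S. sm (Poly_Mapping.lookup x g) (\<rho> g m))"
proof -
  interpret vector_space sm by (rule assms)
  show ?thesis
    unfolding ga_act_def using assms
    by (intro sum.mono_neutral_left) (auto simp: in_keys_iff)
qed

lemma ga_act_single:
  assumes "vector_space sm"
  shows "ga_act sm \<rho> (Poly_Mapping.single g c) m = sm c (\<rho> g m)"
  by (subst ga_act_superset[OF assms, of "{g}"]) auto

lemma ga_act_add:
  assumes "vector_space sm"
  shows "ga_act sm \<rho> (x + y) m = ga_act sm \<rho> x m + ga_act sm \<rho> y m"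
proof -
  interpret vector_space sm by (rule assms)
  let ?S = "Poly_Mapping.keys x \<union> Poly_Mapping.keys y"
  have "ga_act sm \<rho> r m = (\<Sum>g\<in>?S. sm (Poly_Mapping.lookup r g) (\<rho> g m))" if "r \<in> {x, y, x + y}" for r
    by (rule ga_act_superset) (use assms that keys_add[of x y] in auto)
  then show ?thesis by (simp add: lookup_add scale_left_distrib sum.distrib)
qed

lemma ga_act_sum:
  assumes "vector_space sm"
  shows "ga_act sm \<rho> (sum f A) m = (\<Sum>i\<in>A. ga_act sm \<rho> (f i) m)"
proof (induction A rule: infinite_finite_induct)
  case (insert i A)
  then show ?case by (simp add: ga_act_add[OF assms])
qed (simp_all add: ga_act_def)

locale bethe = affine_roots R F \<theta> X
  for R F X :: "('v::euclidean_space \<Rightarrow>\<^sub>L real) set" and \<theta> +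
  fixes k :: "('v \<Rightarrow> real) \<Rightarrow> complex"
    and sm :: "complex \<Rightarrow> 'm::ab_group_add \<Rightarrow> 'm"
    and \<rho> :: "('v \<Rightarrow> 'v) \<Rightarrow> 'm \<Rightarrow> 'm"
    and J :: "('v \<Rightarrow> 'v) \<Rightarrow> ('v \<Rightarrow>\<^sub>L complex) \<Rightarrow> 'v grp_alg"
    and Q :: "('v \<Rightarrow> 'v) \<Rightarrow> ('v \<Rightarrow> 'm) \<Rightarrow> ('v \<Rightarrow> 'm)"
    and lam :: "'v \<Rightarrow>\<^sub>L complex"
    and m :: 'm
  assumes k: "multiplicity_function R X k"
    and module: "aff_weyl_module R X sm \<rho>"
    and Q: "Q_rep R X F \<theta> k sm \<rho> Q"
    and lam: "lam \<in> C_reg R k"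
    and cocycle: "cocycle R X F \<theta> k lam J"
begin

lemma vector_space_sm: "vector_space sm"
  using module by (simp add: aff_weyl_module_def)

sublocale M: vector_space sm
  by (rule vector_space_sm)

lemma rho_linear: "g \<in> Wa \<Longrightarrow> Vector_Spaces.linear sm sm (\<rho> g)"
  and rho_id: "\<rho> id = id"
  and rho_comp: "g \<in> Wa \<Longrightarrow> h \<in> Wa \<Longrightarrow> \<rho> (g \<circ> h) = \<rho> g \<circ> \<rho> h"
  using module by (auto simp: aff_weyl_module_def)

lemma ga_act_scale:
  assumes "x \<in> grp_alg R X"
  shows "ga_act sm \<rho> x (sm b u) = sm b (ga_act sm \<rho> x u)"
proof -
  have "\<rho> g (sm b u) = sm b (\<rho> g u)" if "g \<in> Poly_Mapping.keys x" for g
  proof -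
    interpret L: Vector_Spaces.linear sm sm "\<rho> g"
      using rho_linear assms that by (auto simp: grp_alg_def)
    show ?thesis by (rule L.scale)
  qed
  then show ?thesis
    by (simp add: ga_act_def M.scale_sum_right mult.commute)
qed

lemma ga_act_mult:
  assumes "x \<in> grp_alg R X" "y \<in> grp_alg R X"
  shows "ga_act sm \<rho> (ga_mult x y) u = ga_act sm \<rho> x (ga_act sm \<rho> y u)"
proof -
  have "\<rho> g (ga_act sm \<rho> y u) =
      (\<Sum>h\<in>Poly_Mapping.keys y. sm (Poly_Mapping.lookup y h) (\<rho> (g \<circ> h) u))"
    if "g \<in> Poly_Mapping.keys x" for g
  proof -
    have g: "g \<in> Wa" using assms that by (auto simp: grp_alg_def)
    interpret L: Vector_Spaces.linear sm sm "\<rho> g" by (rule rho_linear[OF g])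
    have "\<rho> (g \<circ> h) u = \<rho> g (\<rho> h u)" if "h \<in> Poly_Mapping.keys y" for h
      using rho_comp[OF g, of h] assms that by (auto simp: grp_alg_def)
    then show ?thesis by (simp add: ga_act_def L.sum L.scale)
  qed
  then show ?thesis
    by (simp add: ga_mult_def ga_act_sum[OF vector_space_sm] ga_act_single[OF vector_space_sm]
        ga_act_def[of _ _ x] M.scale_sum_right)
qed

section \<open>The cocycle on the orbit of the spectral parameter\<close>

text \<open>Orbit points are labelled by group elements, so coefficients indexed by the orbit become
  functions of \<open>w\<close> and are well defined without reference to the stabilizer.\<close>

definition orb :: "('v \<Rightarrow> 'v) \<Rightarrow> 'v \<Rightarrow>\<^sub>L complex" where
  "orb w = dual_act w lam"

lemma orb_apply: "w \<in> weyl R \<Longrightarrow> blinfun_apply (orb w) v = blinfun_apply lam (inv w v)"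
  by (simp add: orb_def dual_act_eq_pull apply_pull weyl_inv)

lemma orb_id: "orb id = lam"
  by (simp add: orb_def dual_act_eq_pull)

lemma inv_weyl_comp: "u \<in> weyl R \<Longrightarrow> w \<in> weyl R \<Longrightarrow> inv (u \<circ> w) = inv w \<circ> inv u"
  by (simp add: o_inv_distrib weyl_bij)

lemma orb_comp_apply:
  "u \<in> weyl R \<Longrightarrow> w \<in> weyl R \<Longrightarrow> blinfun_apply (orb (u \<circ> w)) v = blinfun_apply (orb w) (inv u v)"
  using weyl_comp[of u w] by (simp add: orb_apply inv_weyl_comp del: comp_apply) simp

lemma dual_act_orb: "u \<in> weyl R \<Longrightarrow> w \<in> weyl R \<Longrightarrow> dual_act u (orb w) = orb (u \<circ> w)"
  by (rule blinfun_eqI) (simp add: orb_comp_apply dual_act_eq_pull apply_pull weyl_inv)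

lemma inj_orb: "inj_on orb (weyl R)"
proof (rule inj_onI)
  fix u w assume uw: "u \<in> weyl R" "w \<in> weyl R" "orb u = orb w"
  have v: "inv u \<circ> w \<in> weyl R" using uw weyl_comp weyl_inv by blast
  have "pull (inv u \<circ> w) lam = lam"
  proof (rule blinfun_eqI)
    fix x
    have "blinfun_apply lam (inv u (w x)) = blinfun_apply (orb w) (w x)"
      using uw orb_apply[of u "w x"] by simp
    then show "blinfun_apply (pull (inv u \<circ> w) lam) x = blinfun_apply lam x"
      unfolding apply_pull[OF v] using orb_apply uw by simp
  qed
  moreover have "blinfun_apply lam (coroot \<alpha>) \<noteq> 0" if "\<alpha> \<in> R" for \<alpha>
  proof -
    have "aff_fun \<alpha> 0 \<in> aff_roots R" using that by (auto simp: aff_roots_def)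
    then show ?thesis using lam grad_aff_fun[of \<alpha> 0] unfolding C_reg_def by fastforce
  qed
  ultimately have "inv u \<circ> w = id" using weyl_trivial_stabilizer_complex[OF v] by blast
  then show "u = w" using uw(1,2) by (metis comp_apply eq_id_iff ext weyl_inv_apply(2))
qed

text \<open>Regularity of the orbit point at \<open>a\<close> is regularity of \<open>lam\<close> at
  the affine root pulled back by \<open>w\<close>; invariance of \<open>k\<close> gives both roots
  the same multiplicity.\<close>

lemma orb_C_reg:
  assumes "w \<in> weyl R" "a \<in> aff_roots R"
  shows "blinfun_apply (orb w) (aff_coroot a) \<noteq> 0" "blinfun_apply (orb w) (aff_coroot a) \<noteq> k a"
proof -
  obtain \<alpha> p where a: "a = aff_fun \<alpha> p" "\<alpha> \<in> R" using assms(2) by (auto simp: aff_roots_def)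
  let ?b = "aff_fun (pull w \<alpha>) p"
  have b: "?b \<in> aff_roots R" using pull_in_R[OF assms(1) a(2)] by (auto simp: aff_roots_def)
  have "fun_act w ?b = a"
    using assms(1) by (auto simp: fun_act_def a(1) aff_fun_def apply_pull)
  then have kb: "k ?b = k a"
    using k b weyl_in_Wa[OF assms(1)] unfolding multiplicity_function_def by metis
  have "inv w (coroot \<alpha>) = coroot (pull w \<alpha>)"
    using weyl_inv_apply(1)[OF assms(1), of "coroot (pull w \<alpha>)"]
    unfolding weyl_coroot_pull[OF assms(1)] .
  then have "blinfun_apply (orb w) (aff_coroot a) = blinfun_apply lam (aff_coroot ?b)"
    unfolding a(1) grad_aff_fun orb_apply[OF assms(1)] by simp
  then show "blinfun_apply (orb w) (aff_coroot a) \<noteq> 0" "blinfun_apply (orb w) (aff_coroot a) \<noteq> k a"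
    using lam b kb unfolding C_reg_def by auto
qed

lemma orb_in_orbit: "w \<in> weyl R \<Longrightarrow> orb w \<in> (\<lambda>w. dual_act w lam) ` weyl R"
  by (simp add: orb_def)

lemma J_grp_alg: "w \<in> weyl R \<Longrightarrow> g \<in> Wa \<Longrightarrow> J g (orb w) \<in> grp_alg R X"
  using cocycle orb_in_orbit unfolding cocycle_def by blast

lemma J_refl:
  "w \<in> weyl R \<Longrightarrow> a \<in> aff_basis F \<theta> \<Longrightarrow> J (aff_refl a) (orb w) =
     (let z = blinfun_apply (orb w) (aff_coroot a) in
        Poly_Mapping.single (aff_refl a) (z / (z - k a)) +
        Poly_Mapping.single id (k a / (z - k a)))"
  using cocycle orb_in_orbit unfolding cocycle_def by blast

lemma J_omega:
  "w \<in> weyl R \<Longrightarrow> \<omega> \<in> omega_grp R X F \<Longrightarrow> J \<omega> (orb w) = Poly_Mapping.single \<omega> 1"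
  using cocycle orb_in_orbit unfolding cocycle_def by blast

lemma J_comp:
  assumes "w \<in> weyl R" "\<sigma> \<in> Wa" "\<tau> \<in> Wa"
  shows "J (\<sigma> \<circ> \<tau>) (orb w) = ga_mult (J \<sigma> (orb (lin_part R X \<tau> \<circ> w))) (J \<tau> (orb w))"
proof -
  have "J (\<sigma> \<circ> \<tau>) (orb w) = ga_mult (J \<sigma> (dual_act (lin_part R X \<tau>) (orb w))) (J \<tau> (orb w))"
    using cocycle orb_in_orbit[OF assms(1)] assms(2,3) unfolding cocycle_def by blast
  then show ?thesis by (simp only: dual_act_orb lin_part_in_weyl assms)
qed

section \<open>Amplitudes and compatibility\<close>

definition act_J :: "('v \<Rightarrow> 'v) \<Rightarrow> ('v \<Rightarrow> 'v) \<Rightarrow> 'm \<Rightarrow> 'm" where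
  "act_J g w = ga_act sm \<rho> (J g (orb w))"

lemma act_J_scale: "w \<in> weyl R \<Longrightarrow> g \<in> Wa \<Longrightarrow> act_J g w (sm b u) = sm b (act_J g w u)"
  unfolding act_J_def by (rule ga_act_scale[OF J_grp_alg])

lemma act_J_comp:
  assumes "w \<in> weyl R" "\<sigma> \<in> Wa" "\<tau> \<in> Wa"
  shows "act_J (\<sigma> \<circ> \<tau>) w u = act_J \<sigma> (lin_part R X \<tau> \<circ> w) (act_J \<tau> w u)"
  unfolding act_J_def J_comp[OF assms] using assms
  by (intro ga_act_mult J_grp_alg weyl_comp lin_part_in_weyl)

lemma act_J_omega: "w \<in> weyl R \<Longrightarrow> \<omega> \<in> omega_grp R X F \<Longrightarrow> act_J \<omega> w u = \<rho> \<omega> u"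
  by (simp add: act_J_def J_omega ga_act_single[OF vector_space_sm])

definition amplitude :: "('v \<Rightarrow> 'v) \<Rightarrow> 'm" where
  "amplitude w = act_J w id m"

lemma amplitude_id: "amplitude id = m"
  by (simp add: amplitude_def act_J_omega weyl.weyl_id id_in_omega rho_id)

lemma amplitude_comp: "u \<in> weyl R \<Longrightarrow> w \<in> weyl R \<Longrightarrow> amplitude (u \<circ> w) = act_J u w (amplitude w)"
  by (simp add: amplitude_def act_J_comp weyl.weyl_id weyl_in_Wa del: comp_apply)

definition wave :: "('v \<Rightarrow> 'v) \<Rightarrow> 'v \<Rightarrow> complex" where
  "wave w = cexp (orb w)"

lemma wave_analytic: "wave w \<in> real_analytic"
  unfolding wave_def by (rule cexp_real_analytic)

lemma wave_0: "wave w 0 = 1"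
  by (simp add: wave_def cexp_def blinfun.zero_right)

text \<open>The scalar is the contribution of the translation part of \<open>g\<close>. This
  identity also makes the scalars a cocycle.\<close>

lemma wave_inv:
  assumes "w \<in> weyl R" "g \<in> Wa"
  shows "wave w (inv g v) = wave w (inv g 0) * wave (lin_part R X g \<circ> w) v"
  unfolding wave_def cexp_def
  by (simp add: inv_Wa_apply[OF assms(2), of v] blinfun.add_right orb_comp_apply assms
      lin_part_in_weyl exp_add del: comp_apply)

definition compatible :: "('v \<Rightarrow> 'v) \<Rightarrow> bool" where
  "compatible g \<longleftrightarrow> (\<forall>w\<in>weyl R.
     amplitude (lin_part R X g \<circ> w) = sm (wave w (inv g 0)) (act_J g w (amplitude w)))"

lemma compatible_comp:
  assumes "g \<in> Wa" "h \<in> Wa" "compatible g" "compatible h"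
  shows "compatible (g \<circ> h)"
  unfolding compatible_def
proof
  fix w assume w: "w \<in> weyl R"
  let ?h = "lin_part R X h \<circ> w"
  have h: "?h \<in> weyl R" using weyl_comp lin_part_in_weyl assms w by blast
  have "lin_part R X (g \<circ> h) \<circ> w = lin_part R X g \<circ> ?h"
    by (simp only: lin_part_comp[OF assms(1,2)] comp_assoc)
  then have "amplitude (lin_part R X (g \<circ> h) \<circ> w) =
      sm (wave ?h (inv g 0)) (act_J g ?h (sm (wave w (inv h 0)) (act_J h w (amplitude w))))"
    using assms(3,4) h w unfolding compatible_def by metis
  also have "\<dots> = sm (wave ?h (inv g 0) * wave w (inv h 0)) (act_J (g \<circ> h) w (amplitude w))"
    by (simp only: act_J_scale[OF h assms(1)] act_J_comp[OF w assms(1,2)] M.scale_scale)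
  \<comment> \<open>The cocycle rule for the scalars is \<open>wave_inv\<close> for
    \<open>h\<close>, evaluated at the point \<open>inv g 0\<close>.\<close>
  also have "wave ?h (inv g 0) * wave w (inv h 0) = wave w (inv (g \<circ> h) 0)"
    using wave_inv[OF w assms(2), of "inv g 0"]
    by (simp add: o_inv_distrib Wa_bij assms(1,2))
  finally show "amplitude (lin_part R X (g \<circ> h) \<circ> w) =
      sm (wave w (inv (g \<circ> h) 0)) (act_J (g \<circ> h) w (amplitude w))" .
qed

lemma compatible_weyl:
  assumes "u \<in> weyl R"
  shows "compatible u"
proof -
  have "inv u 0 = 0" using linear_0[OF weyl_linear[OF weyl_inv[OF assms]]] .
  then show ?thesis
    unfolding compatible_def using assms by (simp add: amplitude_comp wave_0 del: comp_apply)
qed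

lemma wave_inv_transl: "wave w (inv (transl y) 0) = exp (- blinfun_apply (orb w) y)"
proof -
  have "inv (transl y) = transl (- y)"
    by (rule inv_unique_comp) (simp_all add: transl_add)
  then show ?thesis by (simp add: wave_def cexp_def transl_def blinfun.minus_right)
qed

text \<open>Moving the translation by \<open>y\<close> past \<open>w\<close> turns it into the
  translation by \<open>inv w y\<close>, still in the lattice. The condition at \<open>orb w\<close>
  thus becomes the Bethe equation at \<open>lam\<close> for \<open>inv w y\<close>, with the same
  exponential because \<open>orb w\<close> at \<open>y\<close> is \<open>lam\<close> at
  \<open>inv w y\<close>.\<close>

lemma bethe_imp_compatible_transl:
  assumes bethe: "\<forall>y\<in>dual_lattice X. act_J (transl y) id m = sm (exp (blinfun_apply lam y)) m"
    and y: "y \<in> dual_lattice X"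
  shows "compatible (transl y)"
  unfolding compatible_def
proof
  fix w assume w: "w \<in> weyl R"
  let ?y = "inv w y"
  have y': "?y \<in> dual_lattice X" using weyl_Y weyl_inv w y by blast
  note W = weyl_in_Wa[OF w] transl_in_Wa[OF y] transl_in_Wa[OF y'] weyl.weyl_id[of R]
  have "act_J (transl y) w (amplitude w) = act_J (transl y \<circ> w) id m"
    unfolding amplitude_def by (simp add: act_J_comp W w)
  also have "\<dots> = act_J (w \<circ> transl ?y) id m"
    by (simp only: transl_weyl[OF w])
  also have "\<dots> = act_J w id (act_J (transl ?y) id m)"
    by (simp add: act_J_comp W w y' del: comp_apply)
  also have "\<dots> = sm (exp (blinfun_apply (orb w) y)) (amplitude w)"
    using bethe y' by (simp add: act_J_scale W amplitude_def orb_apply[OF w])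
  finally show "amplitude (lin_part R X (transl y) \<circ> w) =
      sm (wave w (inv (transl y) 0)) (act_J (transl y) w (amplitude w))"
    using y by (simp add: wave_inv_transl exp_minus)
qed

lemma compatible_transl_imp_bethe:
  assumes "compatible (transl y)" "y \<in> dual_lattice X"
  shows "act_J (transl y) id m = sm (exp (blinfun_apply lam y)) m"
proof -
  have "m = sm (exp (- blinfun_apply lam y)) (act_J (transl y) id m)"
    using assms weyl.weyl_id[of R] unfolding compatible_def
    by (auto simp: wave_inv_transl amplitude_id orb_id)
  then have "sm (exp (blinfun_apply lam y)) m =
      sm (exp (blinfun_apply lam y) * exp (- blinfun_apply lam y)) (act_J (transl y) id m)"
    by (metis M.scale_scale)
  then show ?thesis by (simp add: exp_minus)
qed

section \<open>Invariance of the wave function\<close>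

abbreviation "T \<equiv> tensor_space sm real_analytic"

lemma Q_add: "g \<in> Wa \<Longrightarrow> \<phi> \<in> T \<Longrightarrow> \<psi> \<in> T \<Longrightarrow> Q g (\<lambda>v. \<phi> v + \<psi> v) = (\<lambda>v. Q g \<phi> v + Q g \<psi> v)"
  and Q_scale: "g \<in> Wa \<Longrightarrow> \<phi> \<in> T \<Longrightarrow> Q g (\<lambda>v. sm b (\<phi> v)) = (\<lambda>v. sm b (Q g \<phi> v))"
  and Q_comp: "g \<in> Wa \<Longrightarrow> h \<in> Wa \<Longrightarrow> \<phi> \<in> T \<Longrightarrow> Q (g \<circ> h) \<phi> = Q g (Q h \<phi>)"
  using Q unfolding Q_rep_def Let_def by blast+

lemma Q_refl:
  "a \<in> aff_basis F \<theta> \<Longrightarrow> f \<in> real_analytic \<Longrightarrow> Q (aff_refl a) (pure_tensor sm f u) =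
     (\<lambda>v. pure_tensor sm (fun_act (aff_refl a) f) (\<rho> (aff_refl a) u) v
                - sm (k a) (pure_tensor sm (int_op a f) u v))"
  and Q_omega: "\<omega> \<in> omega_grp R X F \<Longrightarrow> f \<in> real_analytic \<Longrightarrow>
    Q \<omega> (pure_tensor sm f u) = pure_tensor sm (fun_act \<omega> f) (\<rho> \<omega> u)"
  using Q unfolding Q_rep_def Let_def by blast+

lemma Q_sum:
  assumes g: "g \<in> Wa" and "finite A" "\<And>i. i \<in> A \<Longrightarrow> f i \<in> real_analytic"
  shows "Q g (\<lambda>v. \<Sum>i\<in>A. pure_tensor sm (f i) (u i) v) =
    (\<lambda>v. \<Sum>i\<in>A. Q g (pure_tensor sm (f i) (u i)) v)"
  using assms(2,3)
proof (induction A rule: finite_induct)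
  case empty
  \<comment> \<open>The empty sum is the zero function, on which \<open>Q g\<close> is known by
    viewing it as a multiple by 0.\<close>
  have "(\<lambda>v. 0) \<in> T" using tensor_space_sum[of "{}"] by simp
  then show ?case using Q_scale[OF g, of "\<lambda>v. 0" 0] by simp
next
  case (insert i A)
  then show ?case
    using Q_add[OF g pure_tensor_in_tensor_space tensor_space_sum, of "f i" A f "u i" u] by simp
qed

definition psi :: "'v \<Rightarrow> 'm" where
  "psi = (\<lambda>v. \<Sum>w\<in>weyl R. pure_tensor sm (wave w) (amplitude w) v)"

lemma psi_in_T: "psi \<in> T"
  unfolding psi_def by (rule tensor_space_sum[OF finite_weyl wave_analytic])

lemma psi_eq_bethe_wave: "psi = bethe_wave R sm \<rho> J lam m"
  unfolding psi_def bethe_wave_def amplitude_def act_J_def orb_id by (simp add: wave_def orb_def)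

lemma wave_in_E_space:
  assumes "w \<in> weyl R"
  shows "wave w \<in> E_space R lam"
proof -
  have "sym_eval p (orb w) = sym_eval p lam" if "p \<in> sym_invariants R" for p
  proof -
    have "sym_act (inv w) p = p" using that weyl_inv[OF assms] by (auto simp: sym_invariants_def)
    then show ?thesis
      using sym_eval_act[of "orb w" lam "inv w" p] by (simp add: orb_apply assms)
  qed
  then show ?thesis
    unfolding E_space_def using wave_analytic by (simp add: wave_def sym_diff_cexp)
qed

lemma psi_in_F_ir: "psi \<in> F_ir R sm lam"
  unfolding psi_def F_ir_def by (rule tensor_space_sum[OF finite_weyl wave_in_E_space])

lemma weyl_sum_shift:
  assumes "u \<in> weyl R"
  shows "(\<Sum>w\<in>weyl R. f (u \<circ> w)) = (\<Sum>w\<in>weyl R. f w)"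
proof (rule sum.reindex_bij_witness[where i = "\<lambda>w. inv u \<circ> w" and j = "\<lambda>w. u \<circ> w"])
  fix w :: "'v \<Rightarrow> 'v"
  show "inv u \<circ> (u \<circ> w) = w" "u \<circ> (inv u \<circ> w) = w"
    using assms by (auto simp: fun_eq_iff)
  show "w \<in> weyl R \<Longrightarrow> u \<circ> w \<in> weyl R" "w \<in> weyl R \<Longrightarrow> inv u \<circ> w \<in> weyl R"
    using assms weyl_comp weyl_inv by blast+
qed simp

text \<open>By the integral formula the reflected exponential receives the operator
  \<open>\<rho> (aff_refl a)\<close> plus \<open>k a / z\<close>. This is (\<open>z - k a\<close>) /
  \<open>z\<close> times the cocycle value of the reflection, while the original exponential keeps
  only - \<open>k a / z\<close>.\<close>

lemma Q_refl_wave: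
  assumes a: "a \<in> aff_basis F \<theta>" and w: "w \<in> weyl R"
  defines "z \<equiv> blinfun_apply (orb w) (aff_coroot a)"
  shows "Q (aff_refl a) (pure_tensor sm (wave w) u) v =
    sm (wave (lin_part R X (aff_refl a) \<circ> w) v)
      (sm ((z - k a) / z) (sm (wave w (inv (aff_refl a) 0)) (act_J (aff_refl a) w u)))
    - sm (wave w v) (sm (k a / z) u)"
proof -
  obtain \<alpha> p where ap: "a = aff_fun \<alpha> p" "\<alpha> \<in> R" using a by (rule aff_basisE)
  have sW: "aff_refl a \<in> Wa" using aff_refl_in_Wa(1) ap by blast
  have inv: "inv (aff_refl a) = aff_refl a" using inv_aff_refl ap by blast
  have z: "z \<noteq> 0" "z - k a \<noteq> 0"
    using orb_C_reg[OF w aff_basis_in_roots[OF a]] by (auto simp: z_def)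
  let ?b = "wave w (inv (aff_refl a) 0)" and ?e = "wave (lin_part R X (aff_refl a) \<circ> w) v"
  have e: "wave w (aff_refl a v) = ?b * ?e"
    using wave_inv[OF w sW, of v] inv by simp
  have J: "act_J (aff_refl a) w u = sm (z / (z - k a)) (\<rho> (aff_refl a) u) + sm (k a / (z - k a)) u"
    unfolding act_J_def J_refl[OF w a] Let_def z_def
    by (simp add: ga_act_add[OF vector_space_sm] ga_act_single[OF vector_space_sm] rho_id)
  have "Q (aff_refl a) (pure_tensor sm (wave w) u) v =
      sm (?b * ?e) (\<rho> (aff_refl a) u) - sm (k a * ((wave w v - ?b * ?e) / z)) u"
    unfolding Q_refl[OF a wave_analytic]
    using int_op_cexp[of "orb w" a v] z(1) e
    by (simp add: pure_tensor_def fun_act_def inv z_def wave_def)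
  also have "k a * ((wave w v - ?b * ?e) / z) = wave w v * (k a / z) - ?e * (?b * (k a / z))"
    by (simp add: right_diff_distrib diff_divide_distrib mult_ac)
  also have "sm (?b * ?e) (\<rho> (aff_refl a) u) - sm (wave w v * (k a / z) - ?e * (?b * (k a / z))) u =
      sm ?e (sm ((z - k a) / z) (sm ?b (act_J (aff_refl a) w u))) - sm (wave w v) (sm (k a / z) u)"
  proof -
    have 1: "(z - k a) / z * (?b * (z / (z - k a))) = ?b"
      "(z - k a) / z * (?b * (k a / (z - k a))) = ?b * (k a / z)"
      using z by (simp_all add: field_simps)
    show ?thesis
      unfolding J M.scale_right_distrib M.scale_scale 1
      by (simp add: M.scale_left_diff_distrib mult.commute mult.left_commute)
  qed
  finally show ?thesis .
qed

text \<open>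
  After the substitution \<open>w \<mapsto> s w\<close> in the diagonal terms, under which \<open>\<mu>(Da\<^sup>\<or>)\<close> changes sign, every
  coefficient carries the common factor \<open>b = (z - k\<^sub>a) / z\<close>.
\<close>

lemma Q_refl_psi:
  assumes a: "a \<in> aff_basis F \<theta>"
  shows "\<exists>b. (\<forall>w\<in>weyl R. b w \<noteq> 0) \<and> (\<forall>v. Q (aff_refl a) psi v - psi v =
    (\<Sum>w\<in>weyl R. sm (wave (lin_part R X (aff_refl a) \<circ> w) v)
      (sm (b w) (sm (wave w (inv (aff_refl a) 0)) (act_J (aff_refl a) w (amplitude w))
        - amplitude (lin_part R X (aff_refl a) \<circ> w)))))"
proof -
  obtain \<alpha> p where ap: "a = aff_fun \<alpha> p" "\<alpha> \<in> R" using a by (rule aff_basisE)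
  have sW: "aff_refl a \<in> Wa" and D: "lin_part R X (aff_refl a) = root_refl \<alpha>"
    using aff_refl_in_Wa ap by blast+
  let ?s = "root_refl \<alpha>" and ?z = "\<lambda>w. blinfun_apply (orb w) (coroot \<alpha>)"
  let ?c = "\<lambda>w. sm (wave w (inv (aff_refl a) 0)) (act_J (aff_refl a) w (amplitude w))"
  let ?b = "\<lambda>w. (?z w - k a) / ?z w"
  have s: "?s \<in> weyl R" using root_refl_in_weyl ap by blast
  have z: "?z w \<noteq> 0" "?z w \<noteq> k a" if "w \<in> weyl R" for w
    using orb_C_reg[OF that aff_basis_in_roots[OF a]] unfolding ap(1) grad_aff_fun by auto
  have zs: "?z (?s \<circ> w) = - ?z w" if "w \<in> weyl R" for w
  proof -
    have \<alpha>: "\<alpha> \<noteq> 0" using root_nonzero ap by blast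
    have "?s (coroot \<alpha>) = - coroot \<alpha>"
      by (simp add: root_refl_def apply_coroot_self[OF \<alpha>] scaleR_2)
    then show ?thesis
      unfolding orb_comp_apply[OF s that] inv_root_refl[OF \<alpha>] by (simp add: blinfun.minus_right)
  qed
  have "Q (aff_refl a) psi v - psi v =
      (\<Sum>w\<in>weyl R. sm (wave (?s \<circ> w) v) (sm (?b w) (?c w - amplitude (?s \<circ> w))))" for v
  proof -
    \<comment> \<open>Everything subtracted at \<open>wave w\<close>: \<open>k a / ?z w\<close>
      comes from the integral operator and 1 from the term \<open>psi v\<close>.\<close>
    let ?h = "\<lambda>w. sm (wave w v) (sm (k a / ?z w + 1) (amplitude w))"
    have "Q (aff_refl a) psi v =
        (\<Sum>w\<in>weyl R. Q (aff_refl a) (pure_tensor sm (wave w) (amplitude w)) v)"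
      unfolding psi_def Q_sum[OF sW finite_weyl wave_analytic] ..
    also have "\<dots> = (\<Sum>w\<in>weyl R. sm (wave (?s \<circ> w) v) (sm (?b w) (?c w))
        - sm (wave w v) (sm (k a / ?z w) (amplitude w)))"
    proof (rule sum.cong[OF refl])
      fix w assume w: "w \<in> weyl R"
      have "aff_coroot a = coroot \<alpha>" unfolding ap(1) grad_aff_fun ..
      then show "Q (aff_refl a) (pure_tensor sm (wave w) (amplitude w)) v =
        sm (wave (?s \<circ> w) v) (sm (?b w) (?c w)) - sm (wave w v) (sm (k a / ?z w) (amplitude w))"
        unfolding Q_refl_wave[OF a w] D by simp
    qed
    finally have "Q (aff_refl a) psi v - psi v =
        (\<Sum>w\<in>weyl R. sm (wave (?s \<circ> w) v) (sm (?b w) (?c w))) - (\<Sum>w\<in>weyl R. ?h w)"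
      unfolding psi_def pure_tensor_def
      by (simp only: sum_subtractf[symmetric] M.scale_left_distrib M.scale_right_distrib M.scale_one
          diff_diff_eq)
    moreover have "(\<Sum>w\<in>weyl R. ?h w) = (\<Sum>w\<in>weyl R. ?h (?s \<circ> w))"
      using weyl_sum_shift[OF s, of ?h] ..
    moreover have "(\<Sum>w\<in>weyl R. ?h (?s \<circ> w)) =
        (\<Sum>w\<in>weyl R. sm (wave (?s \<circ> w) v) (sm (?b w) (amplitude (?s \<circ> w))))"
    proof (rule sum.cong[OF refl])
      fix w assume w: "w \<in> weyl R"
      have "k a / ?z (?s \<circ> w) + 1 = ?b w"
        unfolding zs[OF w] using z(1)[OF w] by (simp add: field_simps)
      then show "?h (?s \<circ> w) = sm (wave (?s \<circ> w) v) (sm (?b w) (amplitude (?s \<circ> w)))" by simp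
    qed
    ultimately show ?thesis
      by (simp only: sum_subtractf M.scale_right_diff_distrib)
  qed
  moreover have "\<forall>w\<in>weyl R. ?b w \<noteq> 0" using z by simp
  ultimately show ?thesis unfolding D by (intro exI[of _ ?b] conjI allI)
qed

text \<open>Length zero elements have no integral term and a trivial cocycle value, so the defect
  has the same shape as for reflections, with factor 1.\<close>

lemma Q_omega_psi:
  assumes \<omega>: "\<omega> \<in> omega_grp R X F"
  shows "Q \<omega> psi v - psi v =
    (\<Sum>w\<in>weyl R. sm (wave (lin_part R X \<omega> \<circ> w) v)
      (sm (wave w (inv \<omega> 0)) (act_J \<omega> w (amplitude w)) - amplitude (lin_part R X \<omega> \<circ> w)))"
proof -
  have W: "\<omega> \<in> Wa" using \<omega> by (simp add: omega_grp_def)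
  let ?u = "lin_part R X \<omega>"
  have "Q \<omega> psi v = (\<Sum>w\<in>weyl R. Q \<omega> (pure_tensor sm (wave w) (amplitude w)) v)"
    unfolding psi_def Q_sum[OF W finite_weyl wave_analytic] ..
  also have "\<dots> = (\<Sum>w\<in>weyl R. sm (wave (?u \<circ> w) v) (sm (wave w (inv \<omega> 0)) (act_J \<omega> w (amplitude w))))"
  proof (rule sum.cong[OF refl])
    fix w assume w: "w \<in> weyl R"
    show "Q \<omega> (pure_tensor sm (wave w) (amplitude w)) v =
      sm (wave (?u \<circ> w) v) (sm (wave w (inv \<omega> 0)) (act_J \<omega> w (amplitude w)))"
      unfolding Q_omega[OF \<omega> wave_analytic]
      unfolding pure_tensor_def fun_act_def act_J_omega[OF w \<omega>] wave_inv[OF w W, of v]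
      by (simp add: mult.commute)
  qed
  finally have "Q \<omega> psi v =
    (\<Sum>w\<in>weyl R. sm (wave (?u \<circ> w) v) (sm (wave w (inv \<omega> 0)) (act_J \<omega> w (amplitude w))))" .
  moreover have "psi v = (\<Sum>w\<in>weyl R. sm (wave (?u \<circ> w) v) (amplitude (?u \<circ> w)))"
    unfolding psi_def pure_tensor_def
    using weyl_sum_shift[OF lin_part_in_weyl[OF W], of "\<lambda>w. sm (wave w v) (amplitude w)"] ..
  ultimately show ?thesis
    by (simp only: sum_subtractf M.scale_right_diff_distrib)
qed

text \<open>A single comparison of coefficients for both kinds of generators. Independence of the
  exponentials makes each coefficient vanish, and \<open>b w \<noteq> 0\<close> allows the factor to
  be cancelled.\<close>

lemma invariant_iff_compatible:
  assumes g: "g \<in> Wa" and b: "\<forall>w\<in>weyl R. b w \<noteq> 0"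
    and diff: "\<forall>v. Q g psi v - psi v = (\<Sum>w\<in>weyl R. sm (wave (lin_part R X g \<circ> w) v)
      (sm (b w) (sm (wave w (inv g 0)) (act_J g w (amplitude w)) - amplitude (lin_part R X g \<circ> w))))"
  shows "Q g psi = psi \<longleftrightarrow> compatible g"
proof
  let ?u = "lin_part R X g"
  let ?r = "\<lambda>w. sm (b w) (sm (wave w (inv g 0)) (act_J g w (amplitude w)) - amplitude (?u \<circ> w))"
  assume "Q g psi = psi"
  then have 0: "(\<Sum>w\<in>weyl R. sm (cexp (orb (?u \<circ> w)) v) (?r w)) = 0" for v
    using diff unfolding wave_def by simp
  have u: "?u \<in> weyl R" using lin_part_in_weyl[OF g] .
  have inj: "inj_on (\<lambda>w. orb (?u \<circ> w)) (weyl R)"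
  proof (rule inj_onI)
    fix w w' assume w: "w \<in> weyl R" "w' \<in> weyl R" "orb (?u \<circ> w) = orb (?u \<circ> w')"
    then have "?u \<circ> w = ?u \<circ> w'" using inj_onD[OF inj_orb] weyl_comp u by blast
    then have "inv ?u (?u (w v)) = inv ?u (?u (w' v))" for v by (metis comp_apply)
    then show "w = w'" using u by auto
  qed
  have "?r w = 0" if "w \<in> weyl R" for w
    by (rule cexp_independent[OF vector_space_sm finite_weyl inj 0 that])
  then show "compatible g" using b by (auto simp: compatible_def)
next
  assume "compatible g"
  then have "Q g psi v - psi v = 0" for v
    using diff by (simp add: compatible_def)
  then show "Q g psi = psi" by auto
qed

lemma aff_refl_invariant_iff:
  assumes "a \<in> aff_basis F \<theta>"
  shows "Q (aff_refl a) psi = psi \<longleftrightarrow> compatible (aff_refl a)"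
proof -
  show ?thesis
    using Q_refl_psi[OF assms] invariant_iff_compatible[OF aff_refl_basis_in_Wa[OF assms]] by blast
qed

lemma omega_invariant_iff:
  assumes "\<omega> \<in> omega_grp R X F"
  shows "Q \<omega> psi = psi \<longleftrightarrow> compatible \<omega>"
proof (rule invariant_iff_compatible[where b = "\<lambda>_. 1"])
  show "\<omega> \<in> Wa" using assms by (simp add: omega_grp_def)
qed (use Q_omega_psi[OF assms] in simp_all)

lemma invariant_iff_bethe:
  "(\<forall>g\<in>Wa. Q g psi = psi) \<longleftrightarrow>
    (\<forall>y\<in>dual_lattice X. act_J (transl y) id m = sm (exp (blinfun_apply lam y)) m)"
proof
  assume inv: "\<forall>g\<in>Wa. Q g psi = psi"
  \<comment> \<open>Invariance can be traded for compatibility only at generators, so general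
    elements, translations among them, are reached by induction.\<close>
  have "compatible g" if "g \<in> Wa" for g
    using that
  proof (induction rule: aff_weyl_generated)
    case (omega \<omega>)
    then show ?case using inv omega_invariant_iff by (auto simp: omega_grp_def)
  next
    case (aff_refl g a)
    then show ?case using inv aff_refl_basis_in_Wa aff_refl_invariant_iff compatible_comp by blast
  qed
  then show "\<forall>y\<in>dual_lattice X. act_J (transl y) id m = sm (exp (blinfun_apply lam y)) m"
    using compatible_transl_imp_bethe transl_in_Wa by blast
next
  assume bethe: "\<forall>y\<in>dual_lattice X. act_J (transl y) id m = sm (exp (blinfun_apply lam y)) m"
  \<comment> \<open>In this direction the normal form \<open>w \<circ> transl y\<close> gives
    compatibility of every element directly.\<close>
  have comp: "compatible g" if "g \<in> Wa" for g
    using that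
  proof (rule aff_weylE)
    fix w y assume "w \<in> weyl R" "y \<in> dual_lattice X" "g = w \<circ> transl y"
    then show ?thesis
      using compatible_comp[OF weyl_in_Wa transl_in_Wa compatible_weyl
          bethe_imp_compatible_transl[OF bethe]] by blast
  qed
  \<comment> \<open>Compatibility yields invariance only at generators; multiplicativity of
    \<open>Q\<close> carries the invariance along words in them.\<close>
  show "\<forall>g\<in>Wa. Q g psi = psi"
  proof
    fix g assume "g \<in> Wa"
    then show "Q g psi = psi"
    proof (induction rule: aff_weyl_generated)
      case (omega \<omega>)
      then show ?case using comp omega_invariant_iff by (auto simp: omega_grp_def)
    next
      case (aff_refl g a)
      then show ?case
        using Q_comp[OF _ aff_refl_basis_in_Wa psi_in_T] comp aff_refl_basis_in_Wa
          aff_refl_invariant_iff by metis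
    qed
  qed
qed

end

theorem theorem5p10:
  fixes R X F :: "('v::euclidean_space \<Rightarrow>\<^sub>L real) set"
    and \<theta> :: "'v \<Rightarrow>\<^sub>L real"
    and k :: "('v \<Rightarrow> real) \<Rightarrow> complex"
    and sm :: "complex \<Rightarrow> 'm::ab_group_add \<Rightarrow> 'm"
    and \<rho> :: "('v \<Rightarrow> 'v) \<Rightarrow> 'm \<Rightarrow> 'm"
    and J :: "('v \<Rightarrow> 'v) \<Rightarrow> ('v \<Rightarrow>\<^sub>L complex) \<Rightarrow> 'v grp_alg"
    and Q :: "('v \<Rightarrow> 'v) \<Rightarrow> ('v \<Rightarrow> 'm) \<Rightarrow> ('v \<Rightarrow> 'm)"
    and lam :: "'v \<Rightarrow>\<^sub>L complex"
    and m :: 'm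
  assumes "root_system R" and "crystallographic R" and "reduced_roots R" and "irreducible_roots R"
    and "admissible_lattice R X"
    and "root_basis R F" and "highest_root R F \<theta>"
    and "multiplicity_function R X k"
    and "aff_weyl_module R X sm \<rho>"
    and "Q_rep R X F \<theta> k sm \<rho> Q"
    and "lam \<in> C_reg R k"
    and "cocycle R X F \<theta> k lam J"
  shows "bethe_wave R sm \<rho> J lam m \<in> F_ir_inv R X sm Q lam \<longleftrightarrow>
    (\<forall>y\<in>dual_lattice X.
       ga_act sm \<rho> (J (transl y) lam) m = sm (exp (blinfun_apply lam y)) m)"
proof -
  interpret bethe R F X \<theta> k sm \<rho> J Q lam m
    by unfold_locales fact+
  show ?thesis
    using invariant_iff_bethe psi_in_F_ir
    unfolding F_ir_inv_def psi_eq_bethe_wave act_J_def orb_id by blast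
qed

end
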